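(* Let $\lambda$ be a Carleson measure on the unit disk $\mathbb{D}$, let $\gamma(z)=\frac{z-i}{z+i}$, and let $\nu=(\gamma^*\lambda)/|\gamma'|$ be the associated measure on the upper half plane $\mathbb{H}$. Then $\lambda\in\mathrm{CM}_0(\mathbb{D})$ if and only if $\nu\in\mathrm{CM}_s(\mathbb{H})$.
   Context: $\gamma$ maps $\mathbb{H}$ conformally onto $\mathbb{D}$. $\gamma^*\lambda$ is the pull-back measure on $\mathbb{H}$, $\gamma^*\lambda(E)=\lambda(\gamma(E))$, and $d\nu(z)=|\gamma'(z)|^{-1}d(\gamma^*\lambda)(z)$. For an interval $I\subset\mathbb{R}$ of length $|I|$ let $Q_I=\{(x,y)\in\mathbb{H}: x\in I,\ y<|I|\}$. A positive measure $\nu$ on $\mathbb{H}$ is a Carleson measure if $\sup_I\nu(Q_I)/|I|<\infty$. $\mathrm{CM}_s(\mathbb{H})$ (strongly vanishing Carleson measures) is the set of Carleson measures $\nu$ on $\mathbb{H}$ such that $\lim_{|I|\to0}\frac{\nu(Q_I)}{|I|}=\lim_{|I|\to\infty}\frac{\nu(Q_I)}{|I|}=0$ (uniformly over intervals of the given length) and $\lim_{|x|\to\infty}\frac{\nu(Q_{I+x})}{|I|}=0$ for each interval $I$, where $x\in\mathbb{R}$ and $I+x=\{t+x:t\in I\}$. On $\mathbb{D}$: for an arc $I\subset S^1$ of length $|I|$ let $Q_I=\{re^{i\theta}: e^{i\theta}\in I,\ 1-\frac{|I|}{2\pi}<r<1\}$. A positive measure $\lambda$ on $\mathbb{D}$ is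 a Carleson measure if $\sup_I\lambda(Q_I)/|I|<\infty$, and $\mathrm{CM}_0(\mathbb{D})$ (vanishing Carleson measures) is the set of Carleson measures with $\lim_{|I|\to0}\lambda(Q_I)/|I|=0$ (uniformly in arcs $I$). *)

theory Defs
  imports "HOL-Complex_Analysis.Complex_Analysis"
begin

definition upper_half_plane :: "complex set" where
  "upper_half_plane = {z. 0 < Im z}"

definition unit_disk :: "complex set" where
  "unit_disk = ball 0 1"

text \<open>
  A positive measure on an open set \<open>S\<close> is a Borel measure on \<open>S\<close> that is finite on the compact
  subsets of \<open>S\<close>.  Finiteness on compact sets is the usual convention, and it matters: no Carleson
  box of the disk contains the origin, so the Carleson condition alone would not
  exclude an infinite point mass there.
\<close>

definition positive_measure_on :: "complex set \<Rightarrow> complex measure \<Rightarrow> bool" where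
  "positive_measure_on S \<mu> \<longleftrightarrow>
     sets \<mu> = sets (restrict_space borel S) \<and>
     (\<forall>K. compact K \<and> K \<subseteq> S \<longrightarrow> emeasure \<mu> K < \<infinity>)"


section \<open>Carleson measures on the upper half plane\<close>

text \<open>Intervals are bounded and nondegenerate, and may be open, closed or half-open.\<close>

definition real_intervals :: "real set set" where
  "real_intervals = {I. is_interval I \<and> bounded I \<and> 0 < measure lborel I}"

definition box_H :: "real set \<Rightarrow> complex set" where
  "box_H I = {z \<in> upper_half_plane. Re z \<in> I \<and> Im z < measure lborel I}"

definition ratio_H :: "complex measure \<Rightarrow> real set \<Rightarrow> ennreal" where
  "ratio_H \<nu> I = emeasure \<nu> (box_H I) / ennreal (measure lborel I)"

definition CM_H :: "complex measure set" where
  "CM_H = {\<nu>. positive_measure_on upper_half_plane \<nu> \<and>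
              (SUP I\<in>real_intervals. ratio_H \<nu> I) < \<infinity>}"

text \<open>
  The supremum over all intervals of a given length expresses that the limits for
  \<open>|I| \<rightarrow> 0\<close> and \<open>|I| \<rightarrow> \<infinity>\<close> are uniform in the position of \<open>I\<close>.
\<close>

definition sup_ratio_H :: "complex measure \<Rightarrow> real \<Rightarrow> ennreal" where
  "sup_ratio_H \<nu> l = (SUP I\<in>{I \<in> real_intervals. measure lborel I = l}. ratio_H \<nu> I)"

definition CM_s_H :: "complex measure set" where
  "CM_s_H = {\<nu> \<in> CM_H.
     (sup_ratio_H \<nu> \<longlongrightarrow> 0) (at_right 0) \<and>
     (sup_ratio_H \<nu> \<longlongrightarrow> 0) at_top \<and>
     (\<forall>I\<in>real_intervals. ((\<lambda>x. ratio_H \<nu> ((\<lambda>t. t + x) ` I)) \<longlongrightarrow> 0) at_infinity)}"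


section \<open>Carleson measures on the unit disk\<close>

text \<open>The whole circle counts as an arc, of length \<open>2 * pi\<close>.\<close>

definition arcs :: "complex set set" where
  "arcs = {cis ` J | J. J \<in> real_intervals \<and> measure lborel J \<le> 2 * pi}"

definition arc_length :: "complex set \<Rightarrow> real" where
  "arc_length I = measure lborel {t \<in> {0..<2 * pi}. cis t \<in> I}"

definition box_D :: "complex set \<Rightarrow> complex set" where
  "box_D I = {complex_of_real r * w | r w. w \<in> I \<and> 1 - arc_length I / (2 * pi) < r \<and> r < 1}"

definition ratio_D :: "complex measure \<Rightarrow> complex set \<Rightarrow> ennreal" where
  "ratio_D \<mu> I = emeasure \<mu> (box_D I) / ennreal (arc_length I)"

definition CM_D :: "complex measure set" where
  "CM_D = {\<mu>. positive_measure_on unit_disk \<mu> \<and> (SUP I\<in>arcs. ratio_D \<mu> I) < \<infinity>}"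

definition sup_ratio_D :: "complex measure \<Rightarrow> real \<Rightarrow> ennreal" where
  "sup_ratio_D \<mu> l = (SUP I\<in>{I \<in> arcs. arc_length I = l}. ratio_D \<mu> I)"

definition CM_0_D :: "complex measure set" where
  "CM_0_D = {\<mu> \<in> CM_D. (sup_ratio_D \<mu> \<longlongrightarrow> 0) (at_right 0)}"


section \<open>Pull-back measures\<close>

definition pullback_measure ::
  "complex set \<Rightarrow> (complex \<Rightarrow> complex) \<Rightarrow> complex measure \<Rightarrow> complex measure" where
  "pullback_measure S g \<mu> =
     measure_of S (sets (restrict_space borel S)) (\<lambda>E. emeasure \<mu> (g ` E))"

text \<open>The next two facts show that \<open>measure_of\<close> is not used outside its intended domain.\<close>

lemma sets_pullback_measure:
  "sets (pullback_measure S g \<mu>) = sets (restrict_space borel S)"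
proof -
  have "sets (restrict_space borel S) \<subseteq> Pow S"
    using sets.space_closed[of "restrict_space borel S"] by (simp add: space_restrict_space)
  then have "sets (pullback_measure S g \<mu>) = sigma_sets S (sets (restrict_space borel S))"
    unfolding pullback_measure_def by (rule sets_measure_of)
  then show ?thesis
    using sets.sigma_sets_eq[of "restrict_space borel S"] by (simp add: space_restrict_space)
qed

lemma emeasure_pullback_measure:
  assumes inj: "inj_on g S"
    and img: "\<And>E. E \<in> sets (restrict_space borel S) \<Longrightarrow> g ` E \<in> sets \<mu>"
    and E: "E \<in> sets (restrict_space borel S)"
  shows "emeasure (pullback_measure S g \<mu>) E = emeasure \<mu> (g ` E)"
proof (rule emeasure_measure_of[OF pullback_measure_def])
  have sub: "A \<subseteq> S" if "A \<in> sets (restrict_space borel S)" for A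
    using sets.sets_into_space[OF that] by (simp add: space_restrict_space)
  then show "sets (restrict_space borel S) \<subseteq> Pow S" by blast
  show "E \<in> sets (pullback_measure S g \<mu>)"
    using E by (simp add: sets_pullback_measure)
  show "positive (sets (pullback_measure S g \<mu>)) (\<lambda>E. emeasure \<mu> (g ` E))"
    by (simp add: positive_def)
  show "countably_additive (sets (pullback_measure S g \<mu>)) (\<lambda>E. emeasure \<mu> (g ` E))"
  proof (rule countably_additiveI)
    fix A :: "nat \<Rightarrow> complex set"
    assume A: "range A \<subseteq> sets (pullback_measure S g \<mu>)" and dis: "disjoint_family A"
    have AS: "A i \<in> sets (restrict_space borel S)" for i
      using A by (auto simp: sets_pullback_measure)
    have "disjoint_family (\<lambda>i. g ` A i)"
      unfolding disjoint_family_on_def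
    proof (intro ballI impI)
      fix m n :: nat assume "m \<noteq> n"
      then have "A m \<inter> A n = {}" using dis by (auto simp: disjoint_family_on_def)
      then show "g ` A m \<inter> g ` A n = {}"
        using inj_on_image_Int[OF inj sub[OF AS] sub[OF AS], of m n] by simp
    qed
    then have "(\<Sum>i. emeasure \<mu> (g ` A i)) = emeasure \<mu> (\<Union>i. g ` A i)"
      using img[OF AS] by (intro suminf_emeasure) auto
    then show "(\<Sum>i. emeasure \<mu> (g ` A i)) = emeasure \<mu> (g ` (\<Union>i. A i))"
      by (simp add: image_UN)
  qed
qed

definition associated_measure ::
  "complex set \<Rightarrow> (complex \<Rightarrow> complex) \<Rightarrow> complex measure \<Rightarrow> complex measure" where
  "associated_measure S g \<mu> =
     density (pullback_measure S g \<mu>) (\<lambda>z. ennreal (inverse (norm (deriv g z))))"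

end

theory Submission
  imports Defs
begin

text \<open>
  Both vanishing conditions say that one and the same function tends to zero at the boundary.
  Test the measures against the kernels
  \<open>(1 - |a|^2) / |1 - cnj a * w|^2\<close> for \<open>a\<close> in the disk and
  \<open>Im \<alpha> / |z - cnj \<alpha>|^2\<close> for \<open>\<alpha>\<close> in the half plane,
  which on the boundary are the Poisson kernels, the second one up to a constant.  The density
  \<open>1 / |\<gamma>'|\<close> in the definition of \<open>\<nu>\<close> is, up to a factor two, what
  these kernels pick up under the Cayley transform, so the integral of the first kernel against
  \<open>\<lambda>\<close> at \<open>a = \<gamma> \<alpha>\<close> is twice the integral of the second
  one against \<open>\<nu>\<close> at \<open>\<alpha>\<close> (\<open>disk_poisson_cayley\<close>).
  It remains to compare boxes with kernels on each side separately, where no change of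
  variables occurs.

  The kernel that belongs to a box is, on that box, at least a constant over the side length.
  Hence each ratio of a box is bounded by the integral at the corresponding point
  (\<open>ratio_D_le_disk_poisson\<close>, \<open>ratio_H_le_halfplane_poisson\<close>).
  Conversely, cut the kernel along the sets where the distance in the denominator is comparable
  to \<open>2^k\<close> times its infimum.  These sets lie in boxes of the corresponding size
  over concentric intervals or arcs, apart from those in the disk whose size is comparable to that
  of the disk and for which finiteness of the total mass is enough, and the inverse square turns the integral into a series of ratios with
  weights \<open>2^-k\<close> (\<open>nn_integral_inverse_square_le_dyadic\<close>).  The Carleson
  condition bounds all the ratios and the vanishing condition makes each single one tend to zero,
  so the sum tends to zero by dominated convergence
  (\<open>tendsto_geometric_suminf_ennreal\<close>).

  The three limits that define \<open>CM_s_H\<close> arise because, under the Cayley transform,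
  approaching the unit circle means leaving every compact subset of the half plane.  This can
  happen in three ways: \<open>Im \<alpha>\<close> tends to zero, \<open>Im \<alpha>\<close> tends to
  infinity, or \<open>|Re \<alpha>|\<close> tends to infinity while \<open>Im \<alpha>\<close> stays
  bounded above and below.
\<close>

section \<open>Integrals of inverse squares and dyadic shells\<close>

text \<open>
  On the shell \<open>2^k * \<delta> \<le> t < 2^(k+1) * \<delta>\<close> the integrand is at most
  \<open>1 / (4^k * \<delta>)\<close>.  One factor \<open>2^k\<close> is spent on normalising the measure
  of the sublevel set by its radius; the other one remains as a summable weight.
\<close>
lemma nn_integral_inverse_square_le_dyadic:
  fixes t :: "'a \<Rightarrow> real"
  assumes t [measurable]: "t \<in> borel_measurable M" and \<delta>: "0 < \<delta>"
    and ge: "\<And>x. x \<in> space M \<Longrightarrow> \<delta> \<le> t x"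
  shows "(\<integral>\<^sup>+x. ennreal (\<delta> / (t x)\<^sup>2) \<partial>M) \<le>
    2 * (\<Sum>k. ennreal ((1/2)^k) *
      (emeasure M {x \<in> space M. t x < 2 ^ Suc k * \<delta>} / ennreal (2 ^ Suc k * \<delta>)))"
proof -
  define E where "E k = {x \<in> space M. t x < 2 ^ Suc k * \<delta>}" for k
  have E [measurable]: "E k \<in> sets M" for k
    unfolding E_def by measurable
  have "ennreal (\<delta> / (t x)\<^sup>2) \<le> (\<Sum>k. ennreal (1 / (4^k * \<delta>)) * indicator (E k) x)"
    if x: "x \<in> space M" for x
  proof -
    define P where "P = (\<lambda>n. t x < 2^n * \<delta>)"
    \<comment> \<open>The shell that contains \<open>x\<close> is found as the first dyadic radius exceeding \<open>t x\<close>.\<close>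
    obtain n where "t x / \<delta> < 2^n"
      using real_arch_pow[of 2 "t x / \<delta>"] by auto
    then have ex: "P n"
      using \<delta> by (simp add: P_def field_simps)
    define m where "m = (LEAST n. P n)"
    have Pm: "P m"
      unfolding m_def by (rule LeastI[of P, OF ex])
    have "\<not> P 0"
      using ge[OF x] by (simp add: P_def)
    then obtain k where k: "m = Suc k"
      using Pm by (cases m) auto
    have lo: "2^k * \<delta> \<le> t x"
      using not_less_Least[of k P] k unfolding m_def[symmetric] by (auto simp: P_def)
    have "\<delta> / (t x)\<^sup>2 \<le> \<delta> / (2^k * \<delta>)\<^sup>2"
      using lo \<delta> by (intro divide_left_mono power_mono mult_pos_pos zero_less_power) (use less_le_trans[OF \<delta> ge[OF x]] in auto)
    also have "\<dots> = 1 / (4^k * \<delta>)"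
    proof -
      have "((2::real)^k)\<^sup>2 = 4^k"
        by (simp add: power2_eq_square flip: power_mult_distrib)
      then show ?thesis
        using \<delta> by (simp add: power_mult_distrib) (simp add: power2_eq_square)
    qed
    finally have "ennreal (\<delta> / (t x)\<^sup>2) \<le> ennreal (1 / (4^k * \<delta>)) * indicator (E k) x"
      using Pm x k by (simp add: E_def P_def ennreal_leI)
    also have "\<dots> \<le> (\<Sum>j. ennreal (1 / (4^j * \<delta>)) * indicator (E j) x)"
      using sum_le_suminf[of "\<lambda>j. ennreal (1 / (4^j * \<delta>)) * indicator (E j) x" "{k}"]
      by (simp del: sum_mult_indicator)
    finally show ?thesis .
  qed
  then have "(\<integral>\<^sup>+x. ennreal (\<delta> / (t x)\<^sup>2) \<partial>M) \<le>
      (\<integral>\<^sup>+x. (\<Sum>k. ennreal (1 / (4^k * \<delta>)) * indicator (E k) x) \<partial>M)"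
    by (rule nn_integral_mono)
  also have "\<dots> = (\<Sum>k. ennreal (1 / (4^k * \<delta>)) * emeasure M (E k))"
    by (subst nn_integral_suminf) (auto simp: nn_integral_cmult_indicator)
  also have "\<dots> = (\<Sum>k. 2 * (ennreal ((1/2)^k) * (emeasure M (E k) / ennreal (2 ^ Suc k * \<delta>))))"
  proof (rule suminf_cong)
    fix k
    have "(1::real) / (4^k * \<delta>) = 2 * ((1/2)^k * inverse (2 ^ Suc k * \<delta>))"
      using \<delta> by (simp add: field_simps flip: power_mult_distrib)
    moreover have "ennreal (2 * ((1/2)^k * inverse (2 ^ Suc k * \<delta>))) =
        2 * (ennreal ((1/2)^k) * ennreal (inverse (2 ^ Suc k * \<delta>)))"
      using \<delta> by (subst ennreal_mult, simp, simp, subst ennreal_mult) simp_all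
    ultimately have "ennreal (1 / (4^k * \<delta>)) = 2 * (ennreal ((1/2)^k) * ennreal (inverse (2 ^ Suc k * \<delta>)))"
      by simp
    moreover have "emeasure M (E k) / ennreal (2 ^ Suc k * \<delta>) =
        ennreal (inverse (2 ^ Suc k * \<delta>)) * emeasure M (E k)"
      using \<delta> by (subst divide_ennreal_def, subst inverse_ennreal) (simp_all add: mult.commute)
    ultimately show "ennreal (1 / (4^k * \<delta>)) * emeasure M (E k) =
        2 * (ennreal ((1/2)^k) * (emeasure M (E k) / ennreal (2 ^ Suc k * \<delta>)))"
      by (simp add: mult.assoc)
  qed
  also have "\<dots> = 2 * (\<Sum>k. ennreal ((1/2)^k) * (emeasure M (E k) / ennreal (2 ^ Suc k * \<delta>)))"
    by simp
  finally show ?thesis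
    unfolding E_def .
qed

lemma suminf_ennreal_half_powers: "(\<Sum>k. ennreal ((1/2)^k)) = 2"
proof -
  have "(\<lambda>k. (1/2::real)^k) sums 2"
    using geometric_sums[of "1/2::real"] by simp
  then show ?thesis
    by (subst suminf_ennreal_eq[where x = 2]) auto
qed

text \<open>
  Dominated convergence for series along an arbitrary filter: the tail is small uniformly in
  \<open>a\<close>, and only finitely many terms are left to take the limit in.
\<close>
lemma tendsto_geometric_suminf_ennreal:
  fixes \<rho> :: "'a \<Rightarrow> nat \<Rightarrow> ennreal"
  assumes M: "M < \<infinity>" and bd: "eventually (\<lambda>a. \<forall>k. \<rho> a k \<le> M) F"
    and lim: "\<And>k. ((\<lambda>a. \<rho> a k) \<longlongrightarrow> 0) F"
  shows "((\<lambda>a. \<Sum>k. ennreal ((1/2)^k) * \<rho> a k) \<longlongrightarrow> 0) F"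
proof (rule order_tendstoI)
  fix e :: ennreal assume "0 < e"
  have "((\<lambda>N. ennreal ((1/2)^N) * (2 * M)) \<longlongrightarrow> ennreal 0 * (2 * M)) sequentially"
    using M by (intro tendsto_mult_ennreal tendsto_ennrealI tendsto_const LIMSEQ_power_zero)
      (auto simp: ennreal_mult_eq_top_iff)
  then have "eventually (\<lambda>N. ennreal ((1/2)^N) * (2 * M) < e) sequentially"
    using \<open>0 < e\<close> by (intro order_tendstoD) auto
  then obtain N where N: "ennreal ((1/2)^N) * (2 * M) < e"
    by (auto simp: eventually_sequentially)
  have "((\<lambda>a. (\<Sum>k<N. ennreal ((1/2)^k) * \<rho> a k) + ennreal ((1/2)^N) * (2 * M)) \<longlongrightarrow>
      (\<Sum>k<N. ennreal ((1/2)^k) * 0) + ennreal ((1/2)^N) * (2 * M)) F"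
    by (intro tendsto_add tendsto_sum tendsto_mult_ennreal lim tendsto_const) auto
  then have "eventually (\<lambda>a. (\<Sum>k<N. ennreal ((1/2)^k) * \<rho> a k) + ennreal ((1/2)^N) * (2 * M) < e) F"
    using N by (intro order_tendstoD) auto
  with bd show "eventually (\<lambda>a. (\<Sum>k. ennreal ((1/2)^k) * \<rho> a k) < e) F"
  proof eventually_elim
    case (elim a)
    have "(\<Sum>k. ennreal ((1/2)^k) * \<rho> a k) =
        (\<Sum>k<N. ennreal ((1/2)^k) * \<rho> a k) + (\<Sum>k. ennreal ((1/2)^(k+N)) * \<rho> a (k+N))"
      by (subst suminf_offset[where i = N]) (auto simp: add.commute)
    also have "(\<Sum>k. ennreal ((1/2)^(k+N)) * \<rho> a (k+N)) \<le> (\<Sum>k. ennreal ((1/2)^k) * (ennreal ((1/2)^N) * M))"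
      using elim(1) by (intro suminf_le) (auto simp: power_add ennreal_mult mult.assoc intro!: mult_left_mono)
    also have "\<dots> = ennreal ((1/2)^N) * (2 * M)"
      by (simp only: ennreal_suminf_multc suminf_ennreal_half_powers) (simp add: ac_simps)
    finally show ?case
      using elim(2) by (auto intro: le_less_trans add_left_mono)
  qed
qed simp

text \<open>
  Markov's inequality, in the form used for boxes: \<open>B\<close> will be a box of size
  \<open>\<delta>\<close> and \<open>t\<close> the distance in the denominator of the kernel.
\<close>
lemma emeasure_le_nn_integral_inverse_square:
  fixes t :: "'a \<Rightarrow> real"
  assumes t [measurable]: "t \<in> borel_measurable M" and \<delta>: "0 < \<delta>" and C: "0 < C"
    and pos: "\<And>x. x \<in> space M \<Longrightarrow> 0 < t x"
    and B: "B \<subseteq> {x \<in> space M. t x \<le> C * \<delta>}"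
  shows "emeasure M B / ennreal \<delta> \<le> ennreal (C\<^sup>2) * (\<integral>\<^sup>+x. ennreal (\<delta> / (t x)\<^sup>2) \<partial>M)"
proof -
  have "emeasure M B \<le> emeasure M {x \<in> space M. t x \<le> C * \<delta>}"
    using B by (intro emeasure_mono) auto
  also have "\<dots> = (\<integral>\<^sup>+x. indicator {x \<in> space M. t x \<le> C * \<delta>} x \<partial>M)"
    by simp
  also have "\<dots> \<le> (\<integral>\<^sup>+x. ennreal (C\<^sup>2 * \<delta>) * ennreal (\<delta> / (t x)\<^sup>2) \<partial>M)"
  proof (rule nn_integral_mono)
    fix x assume x: "x \<in> space M"
    have "1 \<le> (C\<^sup>2 * \<delta>) * (\<delta> / (t x)\<^sup>2)" if "t x \<le> C * \<delta>"
      using power_mono[OF that, of 2] pos[OF x] \<delta> by (simp add: field_simps power2_eq_square)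
    then show "indicator {x \<in> space M. t x \<le> C * \<delta>} x \<le> ennreal (C\<^sup>2 * \<delta>) * ennreal (\<delta> / (t x)\<^sup>2)"
      using \<delta> x by (auto simp: indicator_def ennreal_mult[symmetric] simp del: times_divide_eq_right)
  qed
  also have "\<dots> = ennreal \<delta> * (ennreal (C\<^sup>2) * (\<integral>\<^sup>+x. ennreal (\<delta> / (t x)\<^sup>2) \<partial>M))"
    using \<delta> by (subst nn_integral_cmult) (auto simp: ennreal_mult ac_simps)
  finally have "emeasure M B / ennreal \<delta> \<le>
      (ennreal \<delta> * (ennreal (C\<^sup>2) * (\<integral>\<^sup>+x. ennreal (\<delta> / (t x)\<^sup>2) \<partial>M))) / ennreal \<delta>"
    by (rule divide_right_mono_ennreal)
  also have "\<dots> = ennreal (C\<^sup>2) * (\<integral>\<^sup>+x. ennreal (\<delta> / (t x)\<^sup>2) \<partial>M)"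
    using \<delta> by (intro mult_divide_eq_ennreal[of "ennreal \<delta>", unfolded mult.commute[of _ "ennreal \<delta>"]]) auto
  finally show ?thesis .
qed

lemma ennreal_divide_rescale:
  assumes "0 < c" "0 < R"
  shows "x / ennreal R = ennreal c * (x / ennreal (c * R))"
proof -
  have "x / ennreal R = x * ennreal (inverse R)"
    using assms by (simp add: divide_ennreal_def inverse_ennreal)
  also have "inverse R = c * inverse (c * R)"
    using assms by simp
  also have "x * ennreal \<dots> = ennreal c * (x * ennreal (inverse (c * R)))"
    using assms by (subst ennreal_mult) (auto simp: ac_simps)
  also have "x * ennreal (inverse (c * R)) = x / ennreal (c * R)"
    using assms by (simp add: divide_ennreal_def inverse_ennreal)
  finally show ?thesis .
qed

lemma radius_less_dyadic:
  fixes \<delta> :: real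
  assumes "0 < \<delta>"
  shows "\<delta> < 2 ^ Suc k * \<delta>"
proof -
  have "(1::real) < 2 ^ Suc k" by (rule one_less_power) auto
  then have "1 * \<delta> < 2 ^ Suc k * \<delta>" by (rule mult_strict_right_mono) (rule assms)
  then show ?thesis by simp
qed

lemma filterlim_mult_at_right_0:
  fixes c :: real
  assumes c: "0 < c"
  shows "filterlim (\<lambda>x. c * x) (at_right 0) (at_right 0)"
proof -
  have "((\<lambda>x. c * x) \<longlongrightarrow> 0) (at_right (0::real))"
    by (auto intro!: tendsto_eq_intros)
  moreover have "eventually (\<lambda>x. c * x \<in> {0<..} \<and> c * x \<noteq> 0) (at_right (0::real))"
    using eventually_at_right_less[of "0::real"] by eventually_elim (use c in auto)
  ultimately show ?thesis
    unfolding filterlim_at by blast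
qed

section \<open>Intervals and arcs\<close>

lemma fmeasurable_Icc: "{a..b::real} \<in> fmeasurable lborel"
  by (rule fmeasurableI) (auto simp: emeasure_lborel_Icc_eq)

lemma real_interval_bounds:
  assumes J: "J \<in> real_intervals"
  shows "{Inf J <..< Sup J} \<subseteq> J" "J \<subseteq> {Inf J..Sup J}" "measure lborel J = Sup J - Inf J" "J \<in> sets borel"
    "Inf J < Sup J" "bdd_below J" "J \<noteq> {}"
proof -
  have b: "is_interval J" "bounded J" and pos: "0 < measure lborel J"
    using J by (auto simp: real_intervals_def)
  show ne: "J \<noteq> {}" using pos by auto
  show bb: "bdd_below J" by (rule bounded_imp_bdd_below[OF b(2)])
  have ba: "bdd_above J" by (rule bounded_imp_bdd_above[OF b(2)])
  show 2: "J \<subseteq> {Inf J..Sup J}" using bb ba by (auto intro: cInf_lower cSup_upper)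
  show 1: "{Inf J <..< Sup J} \<subseteq> J"
  proof
    fix x assume "x \<in> {Inf J <..< Sup J}"
    then obtain u v where "u \<in> J" "u < x" "v \<in> J" "x < v"
      using ne bb ba by (auto simp: cInf_less_iff less_cSup_iff)
    then show "x \<in> J"
      using b(1) unfolding is_interval_1 by (meson less_imp_le)
  qed
  show 3: "J \<in> sets borel"
    by (rule real_interval_borel_measurable[OF b(1)])
  have fm: "{Inf J..Sup J} \<in> fmeasurable lborel"
    by (rule fmeasurable_Icc)
  have le: "Inf J \<le> Sup J" using ne bb ba by (meson cInf_le_cSup)
  have "measure lborel J \<le> measure lborel {Inf J..Sup J}"
    using 2 3 by (intro measure_mono_fmeasurable fm) auto
  moreover have "measure lborel {Inf J<..<Sup J} \<le> measure lborel J"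
    using 1 3 by (intro measure_mono_fmeasurable fmeasurableI2[OF fm 2]) auto
  ultimately show 4: "measure lborel J = Sup J - Inf J"
    using le by simp
  show "Inf J < Sup J" using 4 pos by simp
qed

text \<open>
  After a rotation by a multiple of \<open>2 * pi\<close> the interval starts in
  \<open>{0..<2 * pi}\<close> and therefore ends before \<open>4 * pi\<close>, so the parameters of the
  arc in \<open>{0..<2 * pi}\<close> are the union of a piece of the interval and a translate of
  the rest.
\<close>
lemma arc_length_cis:
  assumes J: "J \<in> real_intervals" and le: "measure lborel J \<le> 2 * pi"
  shows "arc_length (cis ` J) = measure lborel J"
proof -
  note J' = real_interval_bounds[OF J]
  define m where "m = \<lfloor>Inf J / (2 * pi)\<rfloor>"
  define c where "c = 2 * pi * of_int m"
  define K where "K = (\<lambda>t. t - c) ` J"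
  define a where "a = Inf J - c"
  have "of_int m \<le> Inf J / (2 * pi)" "Inf J / (2 * pi) < of_int m + 1"
    unfolding m_def by linarith+
  then have a: "0 \<le> a" "a < 2 * pi"
    by (auto simp: a_def c_def field_simps)
  have cisc: "cis (t - c) = cis t" for t
  proof -
    have "cis c = 1"
      unfolding c_def by (rule cis_multiple_2pi) simp
    then show ?thesis by (simp flip: cis_divide)
  qed
  have img: "cis ` K = cis ` J"
    unfolding K_def image_image cisc ..
  have Kvim: "K = (\<lambda>t. c + t) -` J"
    by (force simp: K_def image_iff)
  have Kb: "K \<in> sets borel"
    unfolding Kvim using J'(4) by (intro measurable_sets_borel[of _ borel]) auto
  have Ksub: "K \<subseteq> {a..a + 2 * pi}"
    using J'(2,3) le by (auto simp: K_def a_def)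
  have shift: "measure lborel ((\<lambda>t. d + t) -` A) = measure lborel A" if "A \<in> sets borel" for A and d :: real
  proof -
    have "measure lborel A = measure (distr lborel borel (\<lambda>t. d + t)) A"
      using lborel_distr_plus[of d] by simp
    also have "\<dots> = measure lborel ((\<lambda>t. d + t) -` A)"
      using that by (simp add: measure_distr)
    finally show ?thesis ..
  qed
  have mK: "measure lborel K = measure lborel J"
    using shift[OF J'(4), of c] unfolding Kvim by simp
  define A where "A = K \<inter> {0..<2*pi}"
  define B where "B = (\<lambda>t. 2*pi + t) -` (K \<inter> {2*pi..<4*pi})"
  have S: "{t \<in> {0..<2 * pi}. cis t \<in> cis ` K} = A \<union> B"
  proof (intro equalityI subsetI)
    fix t assume "t \<in> {t \<in> {0..<2 * pi}. cis t \<in> cis ` K}"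
    then obtain s where t: "0 \<le> t" "t < 2 * pi" and s: "s \<in> K" "cis t = cis s"
      by auto
    have sb: "0 \<le> s" "s < 4 * pi" using s(1) Ksub a by auto
    have "cis (s - t) = 1" using s(2) by (simp flip: cis_divide)
    then obtain n :: int where n: "s - t = 2 * pi * n"
      by (auto simp: complex_eq_iff cos_one_2pi_int mult_ac)
    have "-1 < n" "n < 2"
    proof -
      have "2 * pi * (-1) < 2 * pi * n" "2 * pi * n < 2 * pi * 2" using n sb t by linarith+
      then have "(-1::real) < n" "real_of_int n < 2" by (simp_all only: mult_less_cancel_left_pos pi_gt_zero mult_pos_pos zero_less_numeral)
      then show "-1 < n" "n < 2" by linarith+
    qed
    then have "n = 0 \<or> n = 1" by linarith
    then show "t \<in> A \<union> B"
    proof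
      assume "n = 0" then show ?thesis using n s t by (simp add: A_def)
    next
      assume "n = 1"
      then have "s = 2 * pi + t" using n by simp
      then show ?thesis using s t by (auto simp: B_def)
    qed
  next
    fix t assume "t \<in> A \<union> B"
    then show "t \<in> {t \<in> {0..<2 * pi}. cis t \<in> cis ` K}"
    proof
      assume "t \<in> A" then show ?thesis by (auto simp: A_def)
    next
      assume t: "t \<in> B"
      have "cis t = cis (2 * pi + t)" by (simp flip: cis_mult)
      then show ?thesis using t by (auto simp: B_def)
    qed
  qed
  have fmK: "K \<in> fmeasurable lborel"
    using Kb by (intro fmeasurableI2[OF fmeasurable_Icc Ksub]) simp
  have fmA: "A \<in> fmeasurable lborel"
    unfolding A_def by (rule fmeasurableI2[OF fmK]) (use Kb in auto)
  have Bb: "B \<in> sets borel"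
    unfolding B_def using Kb by (intro measurable_sets_borel[of _ borel]) auto
  have fmB: "B \<in> fmeasurable lborel"
  proof (rule fmeasurableI2[OF fmeasurable_Icc])
    show "B \<subseteq> {0..2*pi}" by (auto simp: B_def)
  qed (use Bb in simp)
  \<comment> \<open>The two pieces overlap only if the interval has both endpoints and length \<open>2 * pi\<close>.\<close>
  have AB: "measure lborel (A \<inter> B) = 0"
  proof -
    have "A \<inter> B \<subseteq> {a}"
    proof
      fix t assume "t \<in> A \<inter> B"
      then have "t \<in> {a..a + 2*pi}" "2*pi + t \<in> {a..a + 2*pi}"
        using Ksub by (auto simp: A_def B_def)
      then show "t \<in> {a}" by auto
    qed
    then have "A \<inter> B = {} \<or> A \<inter> B = {a}" by auto
    then show ?thesis by auto
  qed
  have "arc_length (cis ` J) = measure lborel (A \<union> B)"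
    unfolding arc_length_def img[symmetric] S ..
  also have "\<dots> = measure lborel A + measure lborel B"
    using measure_Un3[OF fmA fmB] AB by simp
  also have "measure lborel B = measure lborel (K \<inter> {2*pi..<4*pi})"
    unfolding B_def using Kb by (intro shift) auto
  also have "measure lborel A + \<dots> = measure lborel (A \<union> (K \<inter> {2*pi..<4*pi}))"
  proof -
    have "A \<inter> (K \<inter> {2*pi..<4*pi}) = {}" by (auto simp: A_def)
    moreover have "K \<inter> {2*pi..<4*pi} \<in> fmeasurable lborel"
      by (rule fmeasurableI2[OF fmK]) (use Kb in auto)
    ultimately show ?thesis using measure_Un3[OF fmA, of "K \<inter> {2*pi..<4*pi}"] by simp
  qed
  also have "A \<union> (K \<inter> {2*pi..<4*pi}) = K"
    using Ksub a by (auto simp: A_def)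
  finally show ?thesis using mK by simp
qed

lemma real_intervals_Ioo: "a < b \<Longrightarrow> {a<..<b} \<in> real_intervals"
  by (auto simp: real_intervals_def is_interval_convex_1 intro: bounded_subset[OF bounded_closed_interval[of a b]])

lemma real_intervals_translate:
  assumes I: "I \<in> real_intervals"
  shows "(\<lambda>t. t + x) ` I \<in> real_intervals" "measure lborel ((\<lambda>t. t + x) ` I) = measure lborel I"
    "Inf ((\<lambda>t. t + x) ` I) = Inf I + x"
proof -
  note I' = real_interval_bounds[OF I]
  have b: "is_interval I" "bounded I" using I by (auto simp: real_intervals_def)
  have ne: "I \<noteq> {}" by (rule I')
  have im: "(\<lambda>t. t + x) ` I = (+) x ` I" by (auto simp: add.commute)
  have v: "(\<lambda>t. t + x) ` I = (\<lambda>t. (- x) + t) -` I" by force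
  have "measure lborel I = measure (distr lborel borel (\<lambda>t. (- x) + t)) I"
    unfolding lborel_distr_plus[of "- x"] ..
  also have "\<dots> = measure lborel ((\<lambda>t. (- x) + t) -` I)"
    using I'(4) by (simp add: measure_distr)
  finally show m: "measure lborel ((\<lambda>t. t + x) ` I) = measure lborel I"
    unfolding v ..
  have "is_interval ((\<lambda>t. t + x) ` I)" "bounded ((\<lambda>t. t + x) ` I)"
    unfolding im using b by (auto simp: is_interval_translation bounded_translation)
  then show "(\<lambda>t. t + x) ` I \<in> real_intervals"
    using m I by (simp add: real_intervals_def)
  show "Inf ((\<lambda>t. t + x) ` I) = Inf I + x"
  proof (rule cInf_eq_non_empty)
    show "(\<lambda>t. t + x) ` I \<noteq> {}" using ne by simp
    show "Inf I + x \<le> y" if "y \<in> (\<lambda>t. t + x) ` I" for y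
      using that I'(6) by (auto intro: cInf_lower)
    fix y assume "\<And>u. u \<in> (\<lambda>t. t + x) ` I \<Longrightarrow> y \<le> u"
    then have "y - x \<le> Inf I"
      using ne by (intro cInf_greatest) (auto simp: algebra_simps)
    then show "y \<le> Inf I + x" by simp
  qed
qed

section \<open>Measures on open subsets of the plane\<close>

lemma borel_measurable_restrict_sets:
  assumes "sets \<mu> = sets (restrict_space borel S)" "f \<in> borel_measurable borel"
  shows "f \<in> borel_measurable \<mu>"
  using assms by (simp add: measurable_cong_sets[OF assms(1) refl] measurable_restrict_space1)

lemma positive_measure_onD:
  assumes "positive_measure_on S \<mu>"
  shows "sets \<mu> = sets (restrict_space borel S)" "space \<mu> = S"
    and "compact K \<Longrightarrow> K \<subseteq> S \<Longrightarrow> emeasure \<mu> K < \<infinity>"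
proof -
  show s: "sets \<mu> = sets (restrict_space borel S)"
    using assms by (simp add: positive_measure_on_def)
  show "space \<mu> = S"
    using sets_eq_imp_space_eq[OF s] by (simp add: space_restrict_space)
  show "compact K \<Longrightarrow> K \<subseteq> S \<Longrightarrow> emeasure \<mu> K < \<infinity>"
    using assms by (simp add: positive_measure_on_def)
qed

section \<open>Poisson integrals in the disk\<close>

definition disk_poisson :: "complex measure \<Rightarrow> complex \<Rightarrow> ennreal" where
  "disk_poisson \<mu> a = (\<integral>\<^sup>+w. ennreal ((1 - (norm a)\<^sup>2) / (norm (1 - cnj a * w))\<^sup>2) \<partial>\<mu>)"

text \<open>
  The filter of approach to the unit circle from inside.  Since \<open>at_right 0\<close> excludes
  nonpositive values, it lives on the open disk.
\<close>
definition disk_end :: "complex filter" where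
  "disk_end = filtercomap (\<lambda>a. 1 - (norm a)\<^sup>2) (at_right 0)"

lemma one_minus_norm_le_norm_diff:
  assumes "norm a \<le> 1" "norm w \<le> 1"
  shows "1 - norm a \<le> norm (1 - cnj a * w)" "1 - norm w \<le> norm (1 - cnj a * w)"
proof -
  have "norm a * norm w \<le> norm a" "norm a * norm w \<le> norm w"
    using assms by (simp_all add: mult_left_le mult_left_le_one_le)
  moreover have "1 - norm a * norm w \<le> norm (1 - cnj a * w)"
    using norm_triangle_ineq2[of 1 "cnj a * w"] by (simp add: norm_mult)
  ultimately show "1 - norm a \<le> norm (1 - cnj a * w)" "1 - norm w \<le> norm (1 - cnj a * w)"
    by linarith+
qed

lemma box_D_cis_iff:
  "w \<in> box_D (cis ` J) \<longleftrightarrow>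
    (\<exists>r t. w = of_real r * cis t \<and> t \<in> J \<and> 1 - arc_length (cis ` J) / (2 * pi) < r \<and> r < 1)"
  unfolding box_D_def by blast

text \<open>
  The box over an open arc is the image of an open rectangle under the exponential function.
  Openness is wanted for measurability: monotonicity of the measure requires it of the larger set.
\<close>
lemma open_box_D:
  assumes "a < b" "b - a \<le> pi"
  shows "open (box_D (cis ` {a<..<b}))"
proof -
  define c where "c = 1 - (b - a) / (2 * pi)"
  have c: "0 < c" using assms by (simp add: c_def field_simps)
  have al: "arc_length (cis ` {a<..<b}) = b - a"
    using assms by (subst arc_length_cis) (auto intro: real_intervals_Ioo)
  define U where "U = {z. ln c < Re z \<and> Re z < 0 \<and> a < Im z \<and> Im z < b}"
  have "box_D (cis ` {a<..<b}) = exp ` U"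
  proof (intro equalityI subsetI)
    fix z assume "z \<in> box_D (cis ` {a<..<b})"
    then obtain r t where z: "z = complex_of_real r * cis t" "a < t" "t < b" "c < r" "r < 1"
      unfolding box_D_cis_iff al c_def by auto
    then have "z = exp (Complex (ln r) t)" "Complex (ln r) t \<in> U"
      using c by (auto simp: U_def exp_eq_polar exp_of_real)
    then show "z \<in> exp ` U" by blast
  next
    fix z assume "z \<in> exp ` U"
    then obtain u where u: "z = exp u" "u \<in> U" by blast
    have "c < exp (Re u)"
      using u(2) c by (metis (mono_tags, lifting) U_def exp_less_cancel_iff exp_ln mem_Collect_eq)
    moreover have "z = complex_of_real (exp (Re u)) * cis (Im u)"
      using u(1) by (simp add: exp_eq_polar exp_of_real)
    ultimately show "z \<in> box_D (cis ` {a<..<b})"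
      using u(2) unfolding box_D_cis_iff al c_def[symmetric] U_def
      by (intro exI[of _ "exp (Re u)"] exI[of _ "Im u"]) auto
  qed
  moreover have "open (exp ` U)"
  proof (rule open_mapping_thm[of exp UNIV])
    have "open ({z. ln c < Re z} \<inter> {z. Re z < 0} \<inter> {z. a < Im z} \<inter> {z. Im z < b})"
      by (intro open_Int open_halfspace_Re_gt open_halfspace_Re_lt open_halfspace_Im_gt open_halfspace_Im_lt)
    then show "open U" by (simp add: U_def Collect_conj_eq Int_assoc)
    show "\<not> (exp :: complex \<Rightarrow> complex) constant_on UNIV"
    proof
      assume "(exp :: complex \<Rightarrow> complex) constant_on UNIV"
      then obtain y where y: "\<And>x. exp (x :: complex) = y" by (auto simp: constant_on_def)
      show False using y[of 0] y[of "\<i> * pi"] by simp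
    qed
  qed (auto intro: holomorphic_intros)
  ultimately show ?thesis by simp
qed

text \<open>
  The angle between \<open>w\<close> and \<open>a\<close> is the argument of
  \<open>cnj a * w\<close>, which is within distance \<open>R \<le> 1/2\<close> of \<open>1\<close>.  Its real
  part exceeds \<open>1/2\<close>, so the tangent of the angle is less than \<open>2 * R\<close> in
  absolute value.
  The half-length \<open>pi * R\<close> is chosen so that the box has height exactly \<open>R\<close>.
\<close>
lemma disk_cap_subset_box_D:
  assumes R: "R \<le> 1/2" and a: "a = of_real s * cis \<theta>" "0 \<le> s" "s < 1" "1 - s < R"
  shows "{w \<in> unit_disk. norm (1 - cnj a * w) < R} \<subseteq> box_D (cis ` {\<theta> - pi * R<..<\<theta> + pi * R})"
proof
  fix w assume "w \<in> {w \<in> unit_disk. norm (1 - cnj a * w) < R}"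
  then have w: "norm w < 1" "norm (1 - cnj a * w) < R"
    by (auto simp: unit_disk_def)
  have na: "norm a = s" using a by (simp add: norm_mult)
  define u where "u = cnj a * w"
  define \<psi> where "\<psi> = Arg u"
  have "1 - Re u \<le> norm (1 - u)" "\<bar>Im u\<bar> \<le> norm (1 - u)"
    using abs_Re_le_cmod[of "1 - u"] abs_Im_le_cmod[of "1 - u"] by auto
  then have u: "1/2 < Re u" "\<bar>Im u\<bar> < R"
    using w(2) R by (auto simp: u_def)
  have "\<psi> = arctan (Im u / Re u)"
    unfolding \<psi>_def by (rule arg_conv_arctan) (use u in linarith)
  then have "\<bar>\<psi>\<bar> \<le> \<bar>Im u / Re u\<bar>"
    by (simp only: abs_arctan_le)
  also have "\<bar>Im u / Re u\<bar> < 2 * R"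
  proof -
    have "\<bar>Im u\<bar> < 2 * R * Re u"
      using u mult_strict_left_mono[of "1/2" "Re u" "2 * R"] by simp
    then show ?thesis using u(1) by (simp add: abs_divide divide_less_eq)
  qed
  also have "2 * R \<le> pi * R"
    using pi_gt3 u by (intro mult_right_mono) auto
  finally have \<psi>: "\<bar>\<psi>\<bar> < pi * R" .
  have "u \<noteq> 0" using u(1) by auto
  then have s: "0 < s" using a by (auto simp: u_def)
  have nu: "norm u = s * norm w"
    using na by (simp add: u_def norm_mult)
  have "u = of_real (norm u) * cis \<psi>"
    unfolding \<psi>_def by (rule rcis_cmod_Arg[unfolded rcis_def, symmetric])
  moreover have "u = of_real s * (cis (- \<theta>) * w)"
    by (simp add: u_def a(1) cis_cnj)
  ultimately have "of_real s * (cis (- \<theta>) * w) = of_real s * (of_real (norm w) * cis \<psi>)"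
    unfolding nu by (simp only: of_real_mult mult.assoc)
  then have eq: "cis (- \<theta>) * w = of_real (norm w) * cis \<psi>"
    using s by (simp only: mult_cancel_left of_real_eq_0_iff) auto
  have "w = cis \<theta> * (cis (- \<theta>) * w)"
    by (simp only: mult.assoc[symmetric] cis_mult) simp
  also have "\<dots> = of_real (norm w) * cis (\<theta> + \<psi>)"
    unfolding eq cis_mult[symmetric] by (simp only: mult_ac)
  finally have weq: "w = of_real (norm w) * cis (\<theta> + \<psi>)" .
  have "0 < R" using u by linarith
  moreover have "pi * R \<le> pi * (1/2)" by (rule mult_left_mono) (use R in auto)
  ultimately have "arc_length (cis ` {\<theta> - pi * R<..<\<theta> + pi * R}) = 2 * pi * R"
    by (subst arc_length_cis) (auto intro!: real_intervals_Ioo)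
  moreover have "1 - R < norm w"
    using one_minus_norm_le_norm_diff(2)[of a w] na a w by simp
  moreover have "cis (\<theta> + \<psi>) \<in> cis ` {\<theta> - pi * R<..<\<theta> + pi * R}"
    using \<psi> by (intro imageI) (auto simp: abs_less_iff)
  ultimately show "w \<in> box_D (cis ` {\<theta> - pi * R<..<\<theta> + pi * R})"
    unfolding box_D_def using weq w(1)
    by (intro CollectI exI[of _ "norm w"] exI[of _ "cis (\<theta> + \<psi>)"]) auto
qed

lemma disk_cap_le_arc_ratio:
  assumes \<mu>: "positive_measure_on unit_disk \<mu>" and R: "R \<le> 1/2"
    and a: "a \<in> unit_disk" "1 - norm a < R"
  shows "\<exists>I\<in>arcs. arc_length I = 2 * pi * R \<and>
    emeasure \<mu> {w \<in> unit_disk. norm (1 - cnj a * w) < R} / ennreal R \<le> ennreal (2 * pi) * ratio_D \<mu> I"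
proof -
  note \<mu>' = positive_measure_onD[OF \<mu>]
  have na: "norm a < 1" using a by (simp add: unit_disk_def)
  have R0: "0 < R" using a na by linarith
  define J where "J = {Arg a - pi * R<..<Arg a + pi * R}"
  have le: "pi * R \<le> pi * (1/2)" by (rule mult_left_mono) (use R in auto)
  have J: "J \<in> real_intervals" unfolding J_def using R0 by (auto intro!: real_intervals_Ioo)
  have lJ: "measure lborel J = 2 * pi * R" unfolding J_def using R0 by simp
  have arc: "cis ` J \<in> arcs" "arc_length (cis ` J) = 2 * pi * R"
    using J lJ le arc_length_cis[OF J] by (auto simp: arcs_def)
  have "box_D (cis ` J) \<subseteq> unit_disk"
  proof
    fix w assume "w \<in> box_D (cis ` J)"
    then obtain r t where "w = complex_of_real r * cis t" "1 - R < r" "r < 1"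
      unfolding box_D_def arc(2) by auto
    then show "w \<in> unit_disk" using R by (simp add: unit_disk_def norm_mult)
  qed
  moreover have "open (box_D (cis ` J))"
    unfolding J_def using le R0 by (intro open_box_D) auto
  ultimately have "box_D (cis ` J) \<in> sets \<mu>"
    unfolding \<mu>'(1) by (auto simp: sets_restrict_space_iff unit_disk_def)
  moreover have "{w \<in> unit_disk. norm (1 - cnj a * w) < R} \<subseteq> box_D (cis ` J)"
    unfolding J_def by (rule disk_cap_subset_box_D[where s = "norm a"])
      (use R na a(2) in \<open>auto simp: rcis_cmod_Arg[unfolded rcis_def]\<close>)
  ultimately have "emeasure \<mu> {w \<in> unit_disk. norm (1 - cnj a * w) < R} \<le> emeasure \<mu> (box_D (cis ` J))"
    by (intro emeasure_mono)
  then have "emeasure \<mu> {w \<in> unit_disk. norm (1 - cnj a * w) < R} / ennreal R \<le> emeasure \<mu> (box_D (cis ` J)) / ennreal R"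
    by (rule divide_right_mono_ennreal)
  also have "\<dots> = ennreal (2 * pi) * ratio_D \<mu> (cis ` J)"
    unfolding ratio_D_def arc(2) using R0 by (intro ennreal_divide_rescale) auto
  finally show ?thesis using arc by blast
qed

text \<open>
  The box of the whole circle is the punctured disk; the origin lies in no such box and is covered
  by finiteness on compact sets.
\<close>
lemma emeasure_unit_disk_finite:
  assumes "\<mu> \<in> CM_D"
  shows "emeasure \<mu> unit_disk < \<infinity>"
proof -
  have \<mu>: "positive_measure_on unit_disk \<mu>" and fin: "(SUP I\<in>arcs. ratio_D \<mu> I) < \<infinity>"
    using assms by (auto simp: CM_D_def)
  note \<mu>' = positive_measure_onD[OF \<mu>]
  have J: "{0..<2*pi} \<in> real_intervals"
    by (auto simp: real_intervals_def is_interval_convex_1 intro: bounded_subset[OF bounded_closed_interval[of 0 "2*pi"]])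
  define I where "I = cis ` {0..<2*pi}"
  have I: "I \<in> arcs" "arc_length I = 2 * pi"
    using J arc_length_cis[OF J] unfolding I_def arcs_def by auto
  have box: "box_D I = unit_disk - {0}"
  proof (intro equalityI subsetI)
    fix w assume "w \<in> box_D I"
    then obtain r t where "w = complex_of_real r * cis t" "0 < r" "r < 1"
      using I(2) unfolding I_def box_D_cis_iff by auto
    then show "w \<in> unit_disk - {0}" by (simp add: unit_disk_def norm_mult)
  next
    fix w assume w: "w \<in> unit_disk - {0}"
    have "w = of_real (norm w) * cis (Arg2pi w)"
      using Arg2pi_eq[of w] by (simp add: cis_conv_exp)
    moreover have "cis (Arg2pi w) \<in> I"
      unfolding I_def by (intro imageI) (simp add: Arg2pi_ge_0 Arg2pi_lt_2pi)
    ultimately show "w \<in> box_D I"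
      using w unfolding box_D_def I(2)
      by (intro CollectI exI[of _ "norm w"] exI[of _ "cis (Arg2pi w)"]) (auto simp: unit_disk_def)
  qed
  have "ratio_D \<mu> I < \<infinity>"
    using fin I(1) by (meson SUP_upper le_less_trans)
  then have "emeasure \<mu> (box_D I) < \<infinity>"
    unfolding ratio_D_def I(2) using ennreal_divide_eq_top_iff by (auto simp: less_top[symmetric])
  moreover have "emeasure \<mu> {0} < \<infinity>"
    by (rule \<mu>'(3)) (auto simp: unit_disk_def)
  moreover have "emeasure \<mu> unit_disk \<le> emeasure \<mu> (box_D I) + emeasure \<mu> {0}"
  proof -
    have s: "unit_disk - {0} \<in> sets \<mu>" "{0} \<in> sets \<mu>"
      unfolding \<mu>'(1) by (auto simp: sets_restrict_space_iff unit_disk_def)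
    have "unit_disk = (unit_disk - {0}) \<union> {0}" by (auto simp: unit_disk_def)
    then show ?thesis using emeasure_subadditive[OF s] box by simp
  qed
  ultimately show ?thesis
    by (metis ennreal_add_eq_top infinity_ennreal_def le_less_trans less_top)
qed

text \<open>
  A cap of large radius need not fit into a box, but there finiteness of the total mass suffices.
\<close>
lemma disk_cap_large:
  assumes \<mu>: "positive_measure_on unit_disk \<mu>" and R: "1/2 \<le> R"
  shows "emeasure \<mu> {w \<in> unit_disk. norm (1 - cnj a * w) < R} / ennreal R \<le> 2 * emeasure \<mu> unit_disk"
proof -
  have "unit_disk \<in> sets \<mu>"
    using positive_measure_onD(2)[OF \<mu>] sets.top[of \<mu>] by simp
  then have le: "emeasure \<mu> {w \<in> unit_disk. norm (1 - cnj a * w) < R} \<le> emeasure \<mu> unit_disk"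
    by (intro emeasure_mono) auto
  have "inverse R \<le> 2"
    using R by (simp add: field_simps)
  then have "ennreal (inverse R) \<le> 2"
    using ennreal_leI[of "inverse R" 2] by simp
  moreover have "emeasure \<mu> {w \<in> unit_disk. norm (1 - cnj a * w) < R} / ennreal R =
      ennreal (inverse R) * emeasure \<mu> {w \<in> unit_disk. norm (1 - cnj a * w) < R}"
    using R by (subst divide_ennreal_def, subst inverse_ennreal) (auto simp: mult.commute)
  ultimately show ?thesis
    using le by (simp add: mult_mono)
qed

lemma disk_poisson_le_dyadic:
  assumes \<mu>: "positive_measure_on unit_disk \<mu>" and a: "a \<in> unit_disk"
  shows "disk_poisson \<mu> a \<le> 4 * (\<Sum>k. ennreal ((1/2)^k) *
    (emeasure \<mu> {w \<in> unit_disk. norm (1 - cnj a * w) < 2 ^ Suc k * (1 - norm a)} / ennreal (2 ^ Suc k * (1 - norm a))))"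
    (is "_ \<le> 4 * ?S")
proof -
  note \<mu>' = positive_measure_onD[OF \<mu>]
  have na: "norm a < 1" using a by (simp add: unit_disk_def)
  have meas [measurable]: "(\<lambda>w. norm (1 - cnj a * w)) \<in> borel_measurable \<mu>"
    by (rule borel_measurable_restrict_sets[OF \<mu>'(1)]) simp
  have "disk_poisson \<mu> a \<le> (\<integral>\<^sup>+w. 2 * ennreal ((1 - norm a) / (norm (1 - cnj a * w))\<^sup>2) \<partial>\<mu>)"
    unfolding disk_poisson_def
  proof (rule nn_integral_mono)
    fix w
    have "1 - (norm a)\<^sup>2 = (1 + norm a) * (1 - norm a)"
      by (simp add: power2_eq_square algebra_simps)
    also have "\<dots> \<le> 2 * (1 - norm a)"
      using na by (intro mult_right_mono) auto
    finally have "(1 - (norm a)\<^sup>2) / (norm (1 - cnj a * w))\<^sup>2 \<le> 2 * ((1 - norm a) / (norm (1 - cnj a * w))\<^sup>2)"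
      by (simp add: divide_right_mono)
    then have "ennreal ((1 - (norm a)\<^sup>2) / (norm (1 - cnj a * w))\<^sup>2) \<le> ennreal (2 * ((1 - norm a) / (norm (1 - cnj a * w))\<^sup>2))"
      by (rule ennreal_leI)
    also have "\<dots> = 2 * ennreal ((1 - norm a) / (norm (1 - cnj a * w))\<^sup>2)"
      using na by (subst ennreal_mult) auto
    finally show "ennreal ((1 - (norm a)\<^sup>2) / (norm (1 - cnj a * w))\<^sup>2) \<le> 2 * ennreal ((1 - norm a) / (norm (1 - cnj a * w))\<^sup>2)" .
  qed
  also have "\<dots> = 2 * (\<integral>\<^sup>+w. ennreal ((1 - norm a) / (norm (1 - cnj a * w))\<^sup>2) \<partial>\<mu>)"
    by (rule nn_integral_cmult) measurable
  also have "\<dots> \<le> 2 * (2 * ?S)"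
    unfolding \<mu>'(2)[symmetric]
    by (intro mult_left_mono nn_integral_inverse_square_le_dyadic)
      (use na in \<open>auto simp: \<mu>'(2) unit_disk_def intro!: one_minus_norm_le_norm_diff\<close>)
  finally show ?thesis by (simp add: mult.assoc[symmetric])
qed

lemma disk_cap_bound:
  assumes \<mu>: "\<mu> \<in> CM_D"
  shows "\<exists>M<\<infinity>. \<forall>a\<in>unit_disk. \<forall>R>1 - norm a.
      emeasure \<mu> {w \<in> unit_disk. norm (1 - cnj a * w) < R} / ennreal R \<le> M"
proof (intro exI conjI ballI allI impI)
  have p: "positive_measure_on unit_disk \<mu>" and fin: "(SUP I\<in>arcs. ratio_D \<mu> I) < \<infinity>"
    using \<mu> by (auto simp: CM_D_def)
  let ?M = "max (ennreal (2 * pi) * (SUP I\<in>arcs. ratio_D \<mu> I)) (2 * emeasure \<mu> unit_disk)"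
  show "?M < \<infinity>"
    using fin emeasure_unit_disk_finite[OF \<mu>] by (simp add: ennreal_mult_less_top)
  show "emeasure \<mu> {w \<in> unit_disk. norm (1 - cnj a * w) < R} / ennreal R \<le> ?M"
    if a: "a \<in> unit_disk" "1 - norm a < R" for a R
  proof (cases "R \<le> 1/2")
    case True
    obtain I where I: "I \<in> arcs" and le: "emeasure \<mu> {w \<in> unit_disk. norm (1 - cnj a * w) < R} / ennreal R
        \<le> ennreal (2 * pi) * ratio_D \<mu> I"
      using disk_cap_le_arc_ratio[OF p True a] by blast
    note le
    also have "ennreal (2 * pi) * ratio_D \<mu> I \<le> ennreal (2 * pi) * (SUP I\<in>arcs. ratio_D \<mu> I)"
      by (intro mult_left_mono SUP_upper I) auto
    finally show ?thesis by (simp add: max.coboundedI1)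
  next
    case False
    then show ?thesis using disk_cap_large[OF p, of R a] by (simp add: max.coboundedI2)
  qed
qed

lemma disk_poisson_bounded:
  assumes \<mu>: "\<mu> \<in> CM_D"
  obtains C where "C < \<infinity>" "\<And>a. a \<in> unit_disk \<Longrightarrow> disk_poisson \<mu> a \<le> C"
proof -
  obtain M where M: "M < \<infinity>"
    "\<And>a R. a \<in> unit_disk \<Longrightarrow> 1 - norm a < R \<Longrightarrow>
      emeasure \<mu> {w \<in> unit_disk. norm (1 - cnj a * w) < R} / ennreal R \<le> M"
    using disk_cap_bound[OF \<mu>] by blast
  have p: "positive_measure_on unit_disk \<mu>" using \<mu> by (simp add: CM_D_def)
  show ?thesis
  proof
    show "4 * (2 * M) < \<infinity>" using M(1) by (simp add: ennreal_mult_less_top)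
    fix a assume a: "a \<in> unit_disk"
    then have na: "0 < 1 - norm a" by (simp add: unit_disk_def)
    note disk_poisson_le_dyadic[OF p a]
    also have "(\<Sum>k. ennreal ((1/2)^k) *
    (emeasure \<mu> {w \<in> unit_disk. norm (1 - cnj a * w) < 2 ^ Suc k * (1 - norm a)} / ennreal (2 ^ Suc k * (1 - norm a))))
      \<le> (\<Sum>k. ennreal ((1/2)^k) * M)"
      by (intro suminf_le mult_left_mono M(2)[OF a] radius_less_dyadic[OF na]) auto
    also have "\<dots> = 2 * M" by (simp only: ennreal_suminf_multc suminf_ennreal_half_powers)
    finally show "disk_poisson \<mu> a \<le> 4 * (2 * M)" by (simp add: mult_left_mono)
  qed
qed

lemma eventually_disk_end_unit_disk: "eventually (\<lambda>a. a \<in> unit_disk) disk_end"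
proof -
  have "eventually (\<lambda>x::real. 0 < x) (at_right 0)"
    by (simp add: eventually_at_right_less)
  then have "eventually (\<lambda>a. 0 < 1 - (norm a)\<^sup>2) disk_end"
    unfolding disk_end_def by (rule eventually_filtercomapI)
  then show ?thesis
    by eventually_elim (simp add: unit_disk_def abs_square_less_1)
qed

lemma filterlim_one_minus_norm_disk_end: "filterlim (\<lambda>a. 1 - norm a) (at_right 0) disk_end"
proof -
  have "((\<lambda>a. 1 - (norm a)\<^sup>2) \<longlongrightarrow> 0) disk_end"
    unfolding disk_end_def using filterlim_filtercomap filterlim_at by blast
  then have "((\<lambda>a. 1 - norm a) \<longlongrightarrow> 0) disk_end"
  proof (rule real_tendsto_sandwich[OF _ _ tendsto_const, rotated 2])
    show "eventually (\<lambda>a. 0 \<le> 1 - norm a) disk_end"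
      using eventually_disk_end_unit_disk by eventually_elim (simp add: unit_disk_def)
    show "eventually (\<lambda>a. 1 - norm a \<le> 1 - (norm a)\<^sup>2) disk_end"
      using eventually_disk_end_unit_disk
      by eventually_elim (simp add: unit_disk_def power2_eq_square mult_left_le)
  qed
  moreover have "eventually (\<lambda>a. 1 - norm a \<in> {0<..} \<and> 1 - norm a \<noteq> 0) disk_end"
    using eventually_disk_end_unit_disk by eventually_elim (simp add: unit_disk_def)
  ultimately show ?thesis by (simp add: filterlim_at)
qed

text \<open>
  For fixed \<open>k\<close> the \<open>k\<close>-th dyadic cap at \<open>a\<close> shrinks as
  \<open>a\<close> approaches the circle, so it eventually lies in a box over a short arc.
\<close>
lemma disk_poisson_tendsto_0:
  assumes \<mu>: "\<mu> \<in> CM_0_D"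
  shows "(disk_poisson \<mu> \<longlongrightarrow> 0) disk_end"
proof -
  have cm: "\<mu> \<in> CM_D" and van: "(sup_ratio_D \<mu> \<longlongrightarrow> 0) (at_right 0)"
    using \<mu> by (auto simp: CM_0_D_def)
  have p: "positive_measure_on unit_disk \<mu>" using cm by (simp add: CM_D_def)
  obtain M where M: "M < \<infinity>"
    "\<And>a R. a \<in> unit_disk \<Longrightarrow> 1 - norm a < R \<Longrightarrow>
      emeasure \<mu> {w \<in> unit_disk. norm (1 - cnj a * w) < R} / ennreal R \<le> M"
    using disk_cap_bound[OF cm] by blast
  define \<rho> where "\<rho> a k = emeasure \<mu> {w \<in> unit_disk. norm (1 - cnj a * w) < 2 ^ Suc k * (1 - norm a)} / ennreal (2 ^ Suc k * (1 - norm a))"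
    for a and k :: nat
  have "((\<lambda>a. \<Sum>k. ennreal ((1/2)^k) * \<rho> a k) \<longlongrightarrow> 0) disk_end"
  proof (rule tendsto_geometric_suminf_ennreal[OF M(1)])
    show "eventually (\<lambda>a. \<forall>k. \<rho> a k \<le> M) disk_end"
      using eventually_disk_end_unit_disk
    proof eventually_elim
      case (elim a)
      then show ?case unfolding \<rho>_def
        by (intro allI M(2) radius_less_dyadic) (simp_all add: unit_disk_def)
    qed
  next
    fix k
    have lim: "filterlim (\<lambda>a. c * (1 - norm a)) (at_right 0) disk_end" if "0 < c" for c :: real
      by (rule filterlim_compose[OF filterlim_mult_at_right_0[OF that] filterlim_one_minus_norm_disk_end])
    have "((\<lambda>a. ennreal (2 * pi) * sup_ratio_D \<mu> (2 * pi * 2 ^ Suc k * (1 - norm a))) \<longlongrightarrow> ennreal (2 * pi) * 0) disk_end"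
      by (intro tendsto_mult_ennreal tendsto_const filterlim_compose[OF van] lim) auto
    then have up: "((\<lambda>a. ennreal (2 * pi) * sup_ratio_D \<mu> (2 * pi * 2 ^ Suc k * (1 - norm a))) \<longlongrightarrow> 0) disk_end"
      by simp
    have "eventually (\<lambda>x::real. x < 1/2) (at_right 0)"
      by (rule eventually_at_right_field[THEN iffD2]) (auto intro!: exI[of _ "1/2"])
    then have "eventually (\<lambda>a. 2 ^ Suc k * (1 - norm a) < 1/2) disk_end"
      using lim[of "2 ^ Suc k"] by (auto simp: filterlim_iff)
    then have "eventually (\<lambda>a. \<rho> a k \<le> ennreal (2 * pi) * sup_ratio_D \<mu> (2 * pi * 2 ^ Suc k * (1 - norm a))) disk_end"
      using eventually_disk_end_unit_disk
    proof eventually_elim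
      case (elim a)
      have "1 - norm a < 2 ^ Suc k * (1 - norm a)"
        using elim(2) by (intro radius_less_dyadic) (simp add: unit_disk_def)
      then obtain I where I: "I \<in> arcs" "arc_length I = 2 * pi * (2 ^ Suc k * (1 - norm a))"
          and le: "\<rho> a k \<le> ennreal (2 * pi) * ratio_D \<mu> I"
        unfolding \<rho>_def using disk_cap_le_arc_ratio[OF p less_imp_le[OF elim(1)] elim(2)] by blast
      note le
      also have "ratio_D \<mu> I \<le> sup_ratio_D \<mu> (2 * pi * 2 ^ Suc k * (1 - norm a))"
        unfolding sup_ratio_D_def using I by (intro SUP_upper) (auto simp: mult.assoc)
      finally show ?case by (simp add: mult_left_mono)
    qed
    then show "((\<lambda>a. \<rho> a k) \<longlongrightarrow> 0) disk_end"
      by (intro tendsto_sandwich[OF _ _ tendsto_const up]) auto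
  qed
  then have "((\<lambda>a. 4 * (\<Sum>k. ennreal ((1/2)^k) * \<rho> a k)) \<longlongrightarrow> 4 * 0) disk_end"
    by (intro tendsto_mult_ennreal tendsto_const) auto
  then have up: "((\<lambda>a. 4 * (\<Sum>k. ennreal ((1/2)^k) * \<rho> a k)) \<longlongrightarrow> 0) disk_end"
    by simp
  have "eventually (\<lambda>a. disk_poisson \<mu> a \<le> 4 * (\<Sum>k. ennreal ((1/2)^k) * \<rho> a k)) disk_end"
    using eventually_disk_end_unit_disk
    by eventually_elim (use disk_poisson_le_dyadic[OF p] in \<open>simp add: \<rho>_def\<close>)
  then show ?thesis
    by (intro tendsto_sandwich[OF _ _ tendsto_const up]) auto
qed

lemma norm_one_minus_cis_le: "norm (1 - cis t) \<le> \<bar>t\<bar>"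
proof -
  have "(norm (1 - cis t))\<^sup>2 = (1 - cos t)\<^sup>2 + (sin t)\<^sup>2"
    by (simp add: cmod_power2)
  also have "\<dots> = 2 - 2 * cos t"
    using sin_cos_squared_add[of t] by (simp add: power2_eq_square algebra_simps)
  also have "\<dots> = (2 * sin (t / 2))\<^sup>2"
    using cos_double_sin[of "t / 2"] by (simp add: power_mult_distrib)
  also have "\<dots> \<le> \<bar>t\<bar>\<^sup>2"
    using abs_sin_x_le_abs_x[of "t / 2"] by (subst power2_abs[symmetric], intro power_mono) (auto simp: abs_mult)
  finally show ?thesis by (rule power2_le_imp_le) simp
qed

text \<open>
  The witness lies at the inner edge of the box, over the initial point of the arc.  From there
  every point of the box has \<open>|1 - cnj a * w| \<le> (2 + 2 * pi) * \<delta>\<close>, which is less than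
  \<open>9 * \<delta>\<close>.
\<close>
lemma ratio_D_le_disk_poisson:
  assumes \<mu>: "positive_measure_on unit_disk \<mu>" and I: "I \<in> arcs" and \<delta>: "arc_length I = 2 * pi * \<delta>" "0 < \<delta>" "\<delta> < 1"
  shows "\<exists>a. norm a = 1 - \<delta> \<and> ratio_D \<mu> I \<le> 81 * disk_poisson \<mu> a"
proof -
  note \<mu>' = positive_measure_onD[OF \<mu>]
  obtain J where J: "J \<in> real_intervals" "measure lborel J \<le> 2 * pi" "I = cis ` J"
    using I by (auto simp: arcs_def)
  have lJ: "measure lborel J = 2 * pi * \<delta>" using \<delta>(1) arc_length_cis[OF J(1,2)] J(3) by simp
  define \<theta> where "\<theta> = Inf J"
  define a where "a = of_real (1 - \<delta>) * cis \<theta>"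
  have na: "norm a = 1 - \<delta>" using \<delta> by (simp add: a_def norm_mult del: of_real_diff)
  have "box_D I \<subseteq> {w \<in> space \<mu>. norm (1 - cnj a * w) \<le> 9 * \<delta>}"
  proof
    fix w assume "w \<in> box_D I"
    then obtain r t where w: "w = complex_of_real r * cis t" "t \<in> J" "1 - \<delta> < r" "r < 1"
      using \<delta>(1) unfolding J(3) box_D_cis_iff by auto
    have r0: "0 < r" using w \<delta> by linarith
    have t: "0 \<le> t - \<theta>" "t - \<theta> \<le> 2 * pi * \<delta>"
      using real_interval_bounds(2,3)[OF J(1)] w(2) lJ unfolding \<theta>_def by auto
    define s where "s = (1 - \<delta>) * r"
    have s: "0 \<le> s" "s \<le> 1" "1 - s \<le> 2 * \<delta>"
    proof -
      show "0 \<le> s" "s \<le> 1" using \<delta> r0 w(4) by (auto simp: s_def intro!: mult_le_one)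
      have "(1 - \<delta>) * (1 - \<delta>) \<le> s" unfolding s_def using \<delta> w(3) by (intro mult_left_mono) auto
      moreover have "(1 - \<delta>) * (1 - \<delta>) = 1 - 2 * \<delta> + \<delta> * \<delta>" by (simp add: algebra_simps)
      ultimately show "1 - s \<le> 2 * \<delta>" using zero_le_square[of \<delta>] by linarith
    qed
    have "cnj a * w = of_real s * cis (t - \<theta>)"
      unfolding a_def w(1) s_def by (simp add: cis_cnj cis_mult mult_ac)
    then have "1 - cnj a * w = of_real (1 - s) + of_real s * (1 - cis (t - \<theta>))"
      by (simp add: algebra_simps)
    then have "norm (1 - cnj a * w) \<le> norm (of_real (1 - s) :: complex) + norm (of_real s * (1 - cis (t - \<theta>)))"
      by (metis norm_triangle_ineq)
    also have "\<dots> = (1 - s) + s * norm (1 - cis (t - \<theta>))"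
      unfolding norm_mult norm_of_real using s by simp
    also have "s * norm (1 - cis (t - \<theta>)) \<le> 1 * (t - \<theta>)"
    proof (intro mult_mono s)
      show "norm (1 - cis (t - \<theta>)) \<le> t - \<theta>"
        using norm_one_minus_cis_le[of "t - \<theta>"] t by simp
    qed auto
    also have "(1 - s) + 1 * (t - \<theta>) \<le> 2 * \<delta> + 2 * pi * \<delta>"
      using s t by simp
    also have "\<dots> \<le> 9 * \<delta>"
    proof -
      have "2 * pi * \<delta> \<le> 7 * \<delta>" using \<delta> pi_less_4 pi_approx by (intro mult_right_mono) auto
      then show ?thesis by simp
    qed
    finally show "w \<in> {w \<in> space \<mu>. norm (1 - cnj a * w) \<le> 9 * \<delta>}"
      using w r0 by (simp add: \<mu>'(2) unit_disk_def norm_mult)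
  qed
  moreover have "(\<lambda>w. norm (1 - cnj a * w)) \<in> borel_measurable \<mu>"
    by (rule borel_measurable_restrict_sets[OF \<mu>'(1)]) simp
  moreover have "0 < norm (1 - cnj a * w)" if "w \<in> space \<mu>" for w
  proof -
    have "\<delta> \<le> norm (1 - cnj a * w)"
      using one_minus_norm_le_norm_diff(1)[of a w] that na \<delta> by (simp add: \<mu>'(2) unit_disk_def)
    then show ?thesis using \<delta>(2) by linarith
  qed
  ultimately have "emeasure \<mu> (box_D I) / ennreal \<delta> \<le>
      ennreal (9\<^sup>2) * (\<integral>\<^sup>+w. ennreal (\<delta> / (norm (1 - cnj a * w))\<^sup>2) \<partial>\<mu>)"
    using \<delta> by (intro emeasure_le_nn_integral_inverse_square) auto
  also have "\<dots> \<le> 81 * disk_poisson \<mu> a"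
  proof -
    have "\<delta> \<le> 1 - (norm a)\<^sup>2"
      using \<delta> mult_left_le[of \<delta> \<delta>] unfolding na by (simp add: power2_eq_square algebra_simps)
    then have "(\<integral>\<^sup>+w. ennreal (\<delta> / (norm (1 - cnj a * w))\<^sup>2) \<partial>\<mu>) \<le> disk_poisson \<mu> a"
      unfolding disk_poisson_def by (intro nn_integral_mono ennreal_leI divide_right_mono) auto
    then show ?thesis by (simp add: mult_left_mono)
  qed
  finally have "emeasure \<mu> (box_D I) / ennreal \<delta> \<le> 81 * disk_poisson \<mu> a" .
  moreover have "ratio_D \<mu> I \<le> emeasure \<mu> (box_D I) / ennreal \<delta>"
  proof -
    have "1 \<le> ennreal (2 * pi)"
      using pi_gt3 by (simp add: ennreal_ge_1)
    then have "1 * ratio_D \<mu> I \<le> ennreal (2 * pi) * ratio_D \<mu> I"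
      by (intro mult_right_mono) auto
    also have "\<dots> = emeasure \<mu> (box_D I) / ennreal \<delta>"
      unfolding ratio_D_def \<delta>(1) using \<delta> by (intro ennreal_divide_rescale[symmetric]) auto
    finally show ?thesis by simp
  qed
  ultimately show ?thesis using na by (meson order_trans)
qed

lemma sup_ratio_D_tendsto_0:
  assumes \<mu>: "positive_measure_on unit_disk \<mu>" and lim: "(disk_poisson \<mu> \<longlongrightarrow> 0) disk_end"
  shows "(sup_ratio_D \<mu> \<longlongrightarrow> 0) (at_right 0)"
proof (rule order_tendstoI)
  fix e :: ennreal assume "0 < e"
  \<comment> \<open>Passing to the supremum over all arcs of one length weakens strict inequalities.\<close>
  then obtain e' where e': "0 < e'" "e' < e" using dense by blast
  have "((\<lambda>a. 81 * disk_poisson \<mu> a) \<longlongrightarrow> 81 * 0) disk_end"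
    by (intro tendsto_mult_ennreal tendsto_const lim) auto
  then have "eventually (\<lambda>a. 81 * disk_poisson \<mu> a < e') disk_end"
    using e'(1) by (intro order_tendstoD) auto
  then obtain \<eta> where \<eta>: "0 < \<eta>" "\<And>a. 0 < 1 - (norm a)\<^sup>2 \<Longrightarrow> 1 - (norm a)\<^sup>2 < \<eta> \<Longrightarrow> 81 * disk_poisson \<mu> a < e'"
    unfolding disk_end_def eventually_filtercomap eventually_at_right_field by blast
  have "sup_ratio_D \<mu> l < e" if l: "0 < l" "l < min (2 * pi) (pi * \<eta>)" for l
  proof -
    have "ratio_D \<mu> I \<le> e'" if I: "I \<in> arcs" "arc_length I = l" for I
    proof -
      define \<delta> where "\<delta> = l / (2 * pi)"
      have \<delta>: "arc_length I = 2 * pi * \<delta>" "0 < \<delta>" "\<delta> < 1" "2 * \<delta> < \<eta>"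
        using l I(2) by (auto simp: \<delta>_def field_simps)
      obtain a where a: "norm a = 1 - \<delta>" "ratio_D \<mu> I \<le> 81 * disk_poisson \<mu> a"
        using ratio_D_le_disk_poisson[OF \<mu> I(1) \<delta>(1-3)] by blast
      have "1 - (norm a)\<^sup>2 = 2 * \<delta> - \<delta> * \<delta>"
        unfolding a by (simp add: power2_eq_square algebra_simps)
      moreover have "0 < \<delta> * \<delta>" "\<delta> * \<delta> < \<delta>" using \<delta> by auto
      ultimately have "81 * disk_poisson \<mu> a < e'"
        using \<delta> by (intro \<eta>(2)) linarith+
      then show ?thesis using a(2) by simp
    qed
    then have "sup_ratio_D \<mu> l \<le> e'"
      unfolding sup_ratio_D_def by (intro SUP_least) auto
    then show ?thesis using e'(2) by simp
  qed
  then show "eventually (\<lambda>l. sup_ratio_D \<mu> l < e) (at_right 0)"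
    unfolding eventually_at_right_field using \<eta>(1)
    by (intro exI[of _ "min (2 * pi) (pi * \<eta>)"]) auto
qed simp

section \<open>Poisson integrals in the half plane\<close>

definition halfplane_poisson :: "complex measure \<Rightarrow> complex \<Rightarrow> ennreal" where
  "halfplane_poisson \<mu> \<alpha> = (\<integral>\<^sup>+z. ennreal (Im \<alpha> / (norm (z - cnj \<alpha>))\<^sup>2) \<partial>\<mu>)"

text \<open>
  The filter of leaving all compact subsets of the half plane: up to a factor four, its defining
  function is \<open>1 - |\<gamma> \<alpha>|^2\<close> for the Cayley transform \<open>\<gamma>\<close>.
\<close>
definition halfplane_end :: "complex filter" where
  "halfplane_end = filtercomap (\<lambda>\<alpha>. Im \<alpha> / (norm (\<alpha> + \<i>))\<^sup>2) (at_right 0)"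

lemma eventually_halfplane_end:
  "eventually P halfplane_end \<longleftrightarrow>
    (\<exists>\<eta>>0. \<forall>\<alpha>. 0 < Im \<alpha> \<longrightarrow> Im \<alpha> / (norm (\<alpha> + \<i>))\<^sup>2 < \<eta> \<longrightarrow> P \<alpha>)" (is "?l \<longleftrightarrow> ?r")
proof -
  have pos: "0 < Im \<alpha> / (norm (\<alpha> + \<i>))\<^sup>2 \<longleftrightarrow> 0 < Im \<alpha>" for \<alpha>
  proof
    assume "0 < Im \<alpha>"
    then have "\<alpha> + \<i> \<noteq> 0" by (auto simp: complex_eq_iff)
    then show "0 < Im \<alpha> / (norm (\<alpha> + \<i>))\<^sup>2" using \<open>0 < Im \<alpha>\<close> by simp
  qed (auto simp: zero_less_divide_iff)
  show ?thesis
  proof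
    assume ?l
    then obtain \<eta> where "0 < \<eta>" "\<And>\<alpha>. 0 < Im \<alpha> / (norm (\<alpha> + \<i>))\<^sup>2 \<Longrightarrow> Im \<alpha> / (norm (\<alpha> + \<i>))\<^sup>2 < \<eta> \<Longrightarrow> P \<alpha>"
      unfolding halfplane_end_def eventually_filtercomap eventually_at_right_field by blast
    then show ?r unfolding pos by blast
  next
    assume ?r
    then obtain \<eta> where \<eta>: "0 < \<eta>" "\<And>\<alpha>. 0 < Im \<alpha> \<Longrightarrow> Im \<alpha> / (norm (\<alpha> + \<i>))\<^sup>2 < \<eta> \<Longrightarrow> P \<alpha>"
      by blast
    have "eventually (\<lambda>x::real. 0 < x \<and> x < \<eta>) (at_right 0)"
      unfolding eventually_at_right_field using \<eta>(1) by blast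
    then show ?l
      unfolding halfplane_end_def eventually_filtercomap using \<eta>(2) pos by blast
  qed
qed

lemma eventually_halfplane_end_pos: "eventually (\<lambda>\<alpha>. 0 < Im \<alpha>) halfplane_end"
  unfolding eventually_halfplane_end by (auto intro: exI[of _ 1])

lemma norm_add_ii_power2: "(norm (\<alpha> + \<i>))\<^sup>2 = (Re \<alpha>)\<^sup>2 + (Im \<alpha> + 1)\<^sup>2"
  by (simp add: cmod_power2)

text \<open>
  The three alternatives correspond to the three limits in the definition of
  \<open>CM_s_H\<close>.
\<close>
lemma halfplane_defect_less:
  assumes "0 < Im \<alpha>" "0 < \<eta>" "Im \<alpha> < \<eta> \<or> 1 / Im \<alpha> < \<eta> \<or> Im \<alpha> < \<eta> * (Re \<alpha>)\<^sup>2"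
  shows "Im \<alpha> / (norm (\<alpha> + \<i>))\<^sup>2 < \<eta>"
proof -
  have s: "(norm (\<alpha> + \<i>))\<^sup>2 = (Re \<alpha>)\<^sup>2 + (Im \<alpha>)\<^sup>2 + 2 * Im \<alpha> + 1"
    unfolding norm_add_ii_power2 by (simp add: power2_eq_square algebra_simps)
  have "1 \<le> (norm (\<alpha> + \<i>))\<^sup>2" "(Im \<alpha>)\<^sup>2 \<le> (norm (\<alpha> + \<i>))\<^sup>2" "(Re \<alpha>)\<^sup>2 \<le> (norm (\<alpha> + \<i>))\<^sup>2"
    unfolding s using assms(1) by auto
  then have le: "\<eta> * 1 \<le> \<eta> * (norm (\<alpha> + \<i>))\<^sup>2" "\<eta> * (Im \<alpha>)\<^sup>2 \<le> \<eta> * (norm (\<alpha> + \<i>))\<^sup>2"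
      "\<eta> * (Re \<alpha>)\<^sup>2 \<le> \<eta> * (norm (\<alpha> + \<i>))\<^sup>2"
    using assms(2) by (simp_all only: mult_le_cancel_left_pos)
  have "Im \<alpha> < \<eta> * (norm (\<alpha> + \<i>))\<^sup>2"
    using assms(3)
  proof (elim disjE)
    assume "1 / Im \<alpha> < \<eta>"
    then have "1 < \<eta> * Im \<alpha>" using assms(1) by (simp add: divide_less_eq)
    then have "1 * Im \<alpha> < \<eta> * Im \<alpha> * Im \<alpha>" using assms(1) by (rule mult_strict_right_mono)
    then show ?thesis using le(2) by (simp add: power2_eq_square mult.assoc)
  qed (use le in linarith)+
  moreover have "0 < (norm (\<alpha> + \<i>))\<^sup>2" unfolding s using assms(1) by (intro add_nonneg_pos add_nonneg_nonneg) auto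
  ultimately show ?thesis by (simp add: divide_less_eq)
qed

lemma ratio_H_le_halfplane_poisson:
  assumes \<nu>: "sets \<nu> = sets (restrict_space borel upper_half_plane)" and I: "I \<in> real_intervals"
  shows "ratio_H \<nu> I \<le> 9 * halfplane_poisson \<nu> (Complex (Inf I) (measure lborel I))"
proof -
  define l where "l = measure lborel I"
  define \<alpha> where "\<alpha> = Complex (Inf I) l"
  have l: "0 < l" using I by (simp add: l_def real_intervals_def)
  have sp: "space \<nu> = upper_half_plane"
    using sets_eq_imp_space_eq[OF \<nu>] by (simp add: space_restrict_space)
  have "box_H I \<subseteq> {z \<in> space \<nu>. norm (z - cnj \<alpha>) \<le> 3 * l}"
  proof
    fix z assume z: "z \<in> box_H I"
    then have z': "z \<in> upper_half_plane" "0 < Im z" "Im z < l" "Re z \<in> I"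
      by (auto simp: box_H_def upper_half_plane_def l_def)
    then have "\<bar>Re z - Inf I\<bar> \<le> l"
      using real_interval_bounds(2,3)[OF I] by (auto simp: l_def)
    moreover have "norm (z - cnj \<alpha>) \<le> \<bar>Re (z - cnj \<alpha>)\<bar> + \<bar>Im (z - cnj \<alpha>)\<bar>"
      by (rule cmod_le)
    ultimately show "z \<in> {z \<in> space \<nu>. norm (z - cnj \<alpha>) \<le> 3 * l}"
      using z' l by (simp add: \<alpha>_def sp)
  qed
  moreover have "(\<lambda>z. norm (z - cnj \<alpha>)) \<in> borel_measurable \<nu>"
    by (rule borel_measurable_restrict_sets[OF \<nu>]) simp
  moreover have "0 < norm (z - cnj \<alpha>)" if "z \<in> space \<nu>" for z
    using that l by (auto simp: sp upper_half_plane_def \<alpha>_def complex_eq_iff)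
  ultimately have "emeasure \<nu> (box_H I) / ennreal l \<le>
      ennreal (3\<^sup>2) * (\<integral>\<^sup>+z. ennreal (l / (norm (z - cnj \<alpha>))\<^sup>2) \<partial>\<nu>)"
    using l by (intro emeasure_le_nn_integral_inverse_square) auto
  then show ?thesis
    by (simp add: ratio_H_def halfplane_poisson_def l_def[symmetric] \<alpha>_def)
qed

lemma box_H_in_sets:
  assumes "sets \<nu> = sets (restrict_space borel upper_half_plane)"
  shows "box_H {a<..<b} \<in> sets \<nu>"
proof -
  define l where "l = measure lborel {a<..<b}"
  have "open ({z. 0 < Im z} \<inter> {z. a < Re z} \<inter> {z. Re z < b} \<inter> {z. Im z < l})"
    by (intro open_Int open_halfspace_Re_gt open_halfspace_Re_lt open_halfspace_Im_gt open_halfspace_Im_lt)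
  moreover have "box_H {a<..<b} = {z. 0 < Im z} \<inter> {z. a < Re z} \<inter> {z. Re z < b} \<inter> {z. Im z < l}"
    by (auto simp: box_H_def upper_half_plane_def l_def)
  ultimately have "open (box_H {a<..<b})" by simp
  moreover have "open upper_half_plane"
    unfolding upper_half_plane_def by (rule open_halfspace_Im_gt)
  moreover have "box_H {a<..<b} \<subseteq> upper_half_plane" by (auto simp: box_H_def)
  ultimately show ?thesis
    unfolding assms by (simp add: sets_restrict_space_iff)
qed

text \<open>
  A box over \<open>I\<close> is controlled by the point at height \<open>|I|\<close> above the left
  endpoint of \<open>I\<close>, and this point leaves all compact sets in each of the three limits.
  Finiteness on compact sets is a consequence of the Carleson bound, since a compact set lies in a
  single large box.
\<close>
lemma CM_s_H_if_halfplane_poisson: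
  assumes \<nu>: "sets \<nu> = sets (restrict_space borel upper_half_plane)"
    and bd: "C < \<infinity>" "\<And>\<alpha>. \<alpha> \<in> upper_half_plane \<Longrightarrow> halfplane_poisson \<nu> \<alpha> \<le> C"
    and lim: "(halfplane_poisson \<nu> \<longlongrightarrow> 0) halfplane_end"
  shows "\<nu> \<in> CM_s_H"
proof -
  have "ratio_H \<nu> I \<le> 9 * C" if I: "I \<in> real_intervals" for I
  proof -
    note ratio_H_le_halfplane_poisson[OF \<nu> I]
    also have "9 * halfplane_poisson \<nu> (Complex (Inf I) (measure lborel I)) \<le> 9 * C"
      using I by (intro mult_left_mono bd(2)) (auto simp: upper_half_plane_def real_intervals_def)
    finally show ?thesis .
  qed
  then have "(SUP I\<in>real_intervals. ratio_H \<nu> I) \<le> 9 * C"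
    by (intro SUP_least)
  also have "9 * C < \<infinity>" using bd(1) by (simp add: ennreal_mult_less_top)
  finally have car: "(SUP I\<in>real_intervals. ratio_H \<nu> I) < \<infinity>" .
  have "emeasure \<nu> K < \<infinity>" if K: "compact K" "K \<subseteq> upper_half_plane" for K
  proof -
    obtain B where B: "0 < B" "\<And>z. z \<in> K \<Longrightarrow> norm z \<le> B"
      using compact_imp_bounded[OF K(1)] by (auto simp: bounded_pos)
    define I where "I = {- (B + 1)<..<B + 1}"
    have I: "I \<in> real_intervals" unfolding I_def using B(1) by (intro real_intervals_Ioo) simp
    have mI: "measure lborel I = 2 * (B + 1)" unfolding I_def using B(1) by simp
    have KI: "K \<subseteq> box_H I"
    proof
      fix z assume z: "z \<in> K"
      have "\<bar>Re z\<bar> \<le> B" "\<bar>Im z\<bar> \<le> B"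
        using B(2)[OF z] abs_Re_le_cmod[of z] abs_Im_le_cmod[of z] by linarith+
      then show "z \<in> box_H I"
        using z K(2) unfolding box_H_def mI using B(1) by (auto simp: I_def)
    qed
    have "box_H I \<in> sets \<nu>"
      unfolding I_def by (rule box_H_in_sets[OF \<nu>])
    then have "emeasure \<nu> K \<le> emeasure \<nu> (box_H I)"
      using KI by (intro emeasure_mono)
    also have "\<dots> < \<infinity>"
    proof -
      have "ratio_H \<nu> I < \<infinity>" using car I by (meson SUP_upper le_less_trans)
      then show ?thesis
        unfolding ratio_H_def using ennreal_divide_eq_top_iff by (auto simp: less_top[symmetric])
    qed
    finally show ?thesis .
  qed
  then have CM: "\<nu> \<in> CM_H"
    using car \<nu> by (simp add: CM_H_def positive_measure_on_def)
  have small: "\<exists>\<eta>>0. \<forall>I\<in>real_intervals.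
      Im (Complex (Inf I) (measure lborel I)) / (norm (Complex (Inf I) (measure lborel I) + \<i>))\<^sup>2 < \<eta> \<longrightarrow> ratio_H \<nu> I < e"
    if "0 < e" for e
  proof -
    have "((\<lambda>\<alpha>. 9 * halfplane_poisson \<nu> \<alpha>) \<longlongrightarrow> 9 * 0) halfplane_end"
      by (intro tendsto_mult_ennreal tendsto_const lim) auto
    then have "eventually (\<lambda>\<alpha>. 9 * halfplane_poisson \<nu> \<alpha> < e) halfplane_end"
      using that by (intro order_tendstoD) auto
    then obtain \<eta> where \<eta>: "0 < \<eta>" "\<And>\<alpha>. 0 < Im \<alpha> \<Longrightarrow> Im \<alpha> / (norm (\<alpha> + \<i>))\<^sup>2 < \<eta> \<Longrightarrow> 9 * halfplane_poisson \<nu> \<alpha> < e"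
      unfolding eventually_halfplane_end by blast
    show ?thesis
    proof (intro exI[of _ \<eta>] conjI ballI impI \<eta>(1))
      fix I assume I: "I \<in> real_intervals"
        and le: "Im (Complex (Inf I) (measure lborel I)) / (norm (Complex (Inf I) (measure lborel I) + \<i>))\<^sup>2 < \<eta>"
      have "0 < Im (Complex (Inf I) (measure lborel I))" using I by (simp add: real_intervals_def)
      from \<eta>(2)[OF this le] ratio_H_le_halfplane_poisson[OF \<nu> I] show "ratio_H \<nu> I < e"
        by (rule le_less_trans[rotated])
    qed
  qed
  have sup_small: "\<exists>\<eta>>0. \<forall>l>0. l < \<eta> \<or> 1 / l < \<eta> \<longrightarrow> sup_ratio_H \<nu> l < e" if "0 < e" for e
  proof -
    obtain e' where e': "0 < e'" "e' < e" using dense \<open>0 < e\<close> by blast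
    obtain \<eta> where \<eta>: "0 < \<eta>" "\<And>I. I \<in> real_intervals \<Longrightarrow>
      Im (Complex (Inf I) (measure lborel I)) / (norm (Complex (Inf I) (measure lborel I) + \<i>))\<^sup>2 < \<eta> \<Longrightarrow> ratio_H \<nu> I < e'"
      using small[OF e'(1)] by blast
    have "sup_ratio_H \<nu> l < e" if l: "0 < l" "l < \<eta> \<or> 1 / l < \<eta>" for l
    proof -
      have "sup_ratio_H \<nu> l \<le> e'"
        unfolding sup_ratio_H_def
      proof (rule SUP_least)
        fix I assume "I \<in> {I \<in> real_intervals. measure lborel I = l}"
        then have I: "I \<in> real_intervals" "measure lborel I = l" by auto
        then have "ratio_H \<nu> I < e'"
          using l \<eta>(1) by (intro \<eta>(2) halfplane_defect_less) auto
        then show "ratio_H \<nu> I \<le> e'" by simp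
      qed
      then show ?thesis using e'(2) by simp
    qed
    then show ?thesis using \<eta>(1) by blast
  qed
  have "(sup_ratio_H \<nu> \<longlongrightarrow> 0) (at_right 0)"
  proof (rule order_tendstoI)
    fix e :: ennreal assume "0 < e"
    then show "eventually (\<lambda>l. sup_ratio_H \<nu> l < e) (at_right 0)"
      unfolding eventually_at_right_field using sup_small by meson
  qed simp
  moreover have "(sup_ratio_H \<nu> \<longlongrightarrow> 0) at_top"
  proof (rule order_tendstoI)
    fix e :: ennreal assume "0 < e"
    then obtain \<eta> where \<eta>: "0 < \<eta>" "\<And>l. 0 < l \<Longrightarrow> 1 / l < \<eta> \<Longrightarrow> sup_ratio_H \<nu> l < e"
      using sup_small by meson
    show "eventually (\<lambda>l. sup_ratio_H \<nu> l < e) at_top"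
      using eventually_gt_at_top[of "1 / \<eta>"]
    proof eventually_elim
      case (elim l)
      have "0 < 1 / \<eta>" using \<eta>(1) by simp
      with elim have "0 < l" by linarith
      with elim \<eta>(1) show ?case by (intro \<eta>(2)) (auto simp: field_simps)
    qed
  qed simp
  moreover have "((\<lambda>x. ratio_H \<nu> ((\<lambda>t. t + x) ` I)) \<longlongrightarrow> 0) at_infinity" if I: "I \<in> real_intervals" for I
  proof (rule order_tendstoI)
    fix e :: ennreal assume "0 < e"
    then obtain \<eta> where \<eta>: "0 < \<eta>" "\<And>I. I \<in> real_intervals \<Longrightarrow>
      Im (Complex (Inf I) (measure lborel I)) / (norm (Complex (Inf I) (measure lborel I) + \<i>))\<^sup>2 < \<eta> \<Longrightarrow> ratio_H \<nu> I < e"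
      using small by blast
    define l where "l = measure lborel I"
    have l: "0 < l" using I by (simp add: l_def real_intervals_def)
    define b where "b = \<bar>Inf I\<bar> + 1 + l / \<eta>"
    have "ratio_H \<nu> ((\<lambda>t. t + x) ` I) < e" if x: "b \<le> norm x" for x
    proof (rule \<eta>(2))
      show "(\<lambda>t. t + x) ` I \<in> real_intervals" by (rule real_intervals_translate[OF I])
      have "0 < l / \<eta>" using l \<eta>(1) by simp
      have "1 + l / \<eta> \<le> \<bar>Inf I + x\<bar>" using x by (simp add: b_def)
      then have "(1 + l / \<eta>)\<^sup>2 \<le> \<bar>Inf I + x\<bar>\<^sup>2"
        using \<open>0 < l / \<eta>\<close> by (intro power_mono) auto
      moreover have "l / \<eta> < (1 + l / \<eta>)\<^sup>2"
      proof -
        have sq: "(1 + u)\<^sup>2 = 1 + 2 * u + u\<^sup>2" for u :: real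
          by (simp add: power2_eq_square algebra_simps)
        show ?thesis
          unfolding sq using \<open>0 < l / \<eta>\<close> zero_le_power2[of "l / \<eta>"] by linarith
      qed
      ultimately have "l / \<eta> < (Inf I + x)\<^sup>2" by simp
      then have "l < \<eta> * (Inf I + x)\<^sup>2" using \<eta>(1) by (simp add: field_simps)
      then show "Im (Complex (Inf ((\<lambda>t. t + x) ` I)) (measure lborel ((\<lambda>t. t + x) ` I))) /
          (norm (Complex (Inf ((\<lambda>t. t + x) ` I)) (measure lborel ((\<lambda>t. t + x) ` I)) + \<i>))\<^sup>2 < \<eta>"
        unfolding real_intervals_translate[OF I] l_def[symmetric]
        using l \<eta>(1) by (intro halfplane_defect_less) auto
    qed
    then show "eventually (\<lambda>x. ratio_H \<nu> ((\<lambda>t. t + x) ` I) < e) at_infinity"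
      unfolding eventually_at_infinity by blast
  qed simp
  ultimately show ?thesis
    using CM by (simp add: CM_s_H_def)
qed

lemma halfplane_cap_le_ratio_H:
  assumes \<nu>: "sets \<nu> = sets (restrict_space borel upper_half_plane)" and R: "0 < R" and \<alpha>: "0 < Im \<alpha>"
  shows "emeasure \<nu> {z \<in> upper_half_plane. norm (z - cnj \<alpha>) < R} / ennreal R
    \<le> 2 * ratio_H \<nu> {Re \<alpha> - R<..<Re \<alpha> + R}"
proof -
  define I where "I = {Re \<alpha> - R<..<Re \<alpha> + R}"
  have mI: "measure lborel I = 2 * R" using R by (simp add: I_def)
  have "{z \<in> upper_half_plane. norm (z - cnj \<alpha>) < R} \<subseteq> box_H I"
  proof
    fix z assume z: "z \<in> {z \<in> upper_half_plane. norm (z - cnj \<alpha>) < R}"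
    then have "\<bar>Re z - Re \<alpha>\<bar> < R" "\<bar>Im z + Im \<alpha>\<bar> < R"
      using abs_Re_le_cmod[of "z - cnj \<alpha>"] abs_Im_le_cmod[of "z - cnj \<alpha>"] by auto
    then show "z \<in> box_H I"
      using z R \<alpha> unfolding box_H_def mI by (auto simp: I_def)
  qed
  moreover have "box_H I \<in> sets \<nu>"
    unfolding I_def using box_H_in_sets[OF \<nu>] .
  ultimately have "emeasure \<nu> {z \<in> upper_half_plane. norm (z - cnj \<alpha>) < R} / ennreal R \<le> emeasure \<nu> (box_H I) / ennreal R"
    by (intro divide_right_mono_ennreal emeasure_mono)
  also have "\<dots> = 2 * ratio_H \<nu> I"
    unfolding ratio_H_def mI using R ennreal_divide_rescale[of 2 R] by simp
  finally show ?thesis unfolding I_def .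
qed

lemma halfplane_poisson_le_dyadic:
  assumes \<nu>: "sets \<nu> = sets (restrict_space borel upper_half_plane)" and \<alpha>: "0 < Im \<alpha>"
  shows "halfplane_poisson \<nu> \<alpha> \<le> 4 * (\<Sum>k. ennreal ((1/2)^k) *
    ratio_H \<nu> {Re \<alpha> - 2 ^ Suc k * Im \<alpha><..<Re \<alpha> + 2 ^ Suc k * Im \<alpha>})"
proof -
  have sp: "space \<nu> = upper_half_plane"
    using sets_eq_imp_space_eq[OF \<nu>] by (simp add: space_restrict_space)
  have "halfplane_poisson \<nu> \<alpha> \<le> 2 * (\<Sum>k. ennreal ((1/2)^k) *
      (emeasure \<nu> {z \<in> upper_half_plane. norm (z - cnj \<alpha>) < 2 ^ Suc k * Im \<alpha>} / ennreal (2 ^ Suc k * Im \<alpha>)))"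
    unfolding halfplane_poisson_def sp[symmetric]
  proof (rule nn_integral_inverse_square_le_dyadic[OF _ \<alpha>])
    show "(\<lambda>z. norm (z - cnj \<alpha>)) \<in> borel_measurable \<nu>"
      by (rule borel_measurable_restrict_sets[OF \<nu>]) simp
    show "Im \<alpha> \<le> norm (z - cnj \<alpha>)" if "z \<in> space \<nu>" for z
      using that abs_Im_le_cmod[of "z - cnj \<alpha>"] by (simp add: sp upper_half_plane_def)
  qed
  also have "\<dots> \<le> 2 * (\<Sum>k. ennreal ((1/2)^k) *
      (2 * ratio_H \<nu> {Re \<alpha> - 2 ^ Suc k * Im \<alpha><..<Re \<alpha> + 2 ^ Suc k * Im \<alpha>}))"
    by (intro mult_left_mono suminf_le halfplane_cap_le_ratio_H[OF \<nu>] \<alpha>) (use \<alpha> in auto)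
  also have "\<dots> = 2 * (\<Sum>k. 2 * (ennreal ((1/2)^k) *
      ratio_H \<nu> {Re \<alpha> - 2 ^ Suc k * Im \<alpha><..<Re \<alpha> + 2 ^ Suc k * Im \<alpha>}))"
    by (subst mult.left_commute) (rule refl)
  also have "\<dots> = 4 * (\<Sum>k. ennreal ((1/2)^k) *
      ratio_H \<nu> {Re \<alpha> - 2 ^ Suc k * Im \<alpha><..<Re \<alpha> + 2 ^ Suc k * Im \<alpha>})"
    unfolding ennreal_suminf_cmult mult.assoc[symmetric, of 2 2] by simp
  finally show ?thesis .
qed

text \<open>
  The first two limits dispose of short and long intervals, uniformly in their position.  For the
  lengths in between, an interval centred at \<open>Re \<alpha>\<close> is contained in a translate of one
  fixed interval, to which the third limit applies once \<open>|Re \<alpha>|\<close> is large.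
\<close>
lemma ratio_H_tendsto_0_halfplane_end:
  assumes \<nu>: "\<nu> \<in> CM_s_H" and m: "0 < m"
  shows "((\<lambda>\<alpha>. ratio_H \<nu> {Re \<alpha> - m * Im \<alpha><..<Re \<alpha> + m * Im \<alpha>}) \<longlongrightarrow> 0) halfplane_end"
proof (rule order_tendstoI)
  fix e :: ennreal assume e: "0 < e"
  have lim0: "(sup_ratio_H \<nu> \<longlongrightarrow> 0) (at_right 0)" and limtop: "(sup_ratio_H \<nu> \<longlongrightarrow> 0) at_top"
    and limx: "\<And>I. I \<in> real_intervals \<Longrightarrow> ((\<lambda>x. ratio_H \<nu> ((\<lambda>t. t + x) ` I)) \<longlongrightarrow> 0) at_infinity"
    and sets: "sets \<nu> = sets (restrict_space borel upper_half_plane)"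
    using \<nu> by (auto simp: CM_s_H_def CM_H_def positive_measure_on_def)
  obtain l0 where l0: "0 < l0" "\<And>l. 0 < l \<Longrightarrow> l < l0 \<Longrightarrow> sup_ratio_H \<nu> l < e"
    using order_tendstoD(2)[OF lim0 e] unfolding eventually_at_right_field by blast
  obtain L0 where L0: "\<And>l. L0 \<le> l \<Longrightarrow> sup_ratio_H \<nu> l < e"
    using order_tendstoD(2)[OF limtop e] unfolding eventually_at_top_linorder by blast
  define L where "L = max L0 l0"
  have L: "0 < L" "L0 \<le> L" using l0(1) by (auto simp: L_def)
  define c where "c = 2 * L / l0"
  have c: "0 < c" "c * l0 = 2 * L" using l0(1) L by (auto simp: c_def)
  have "((\<lambda>x. ennreal c * ratio_H \<nu> ((\<lambda>t. t + x) ` {-L<..<L})) \<longlongrightarrow> ennreal c * 0) at_infinity"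
    using L by (intro tendsto_mult_ennreal tendsto_const limx real_intervals_Ioo) auto
  then have "eventually (\<lambda>x. ennreal c * ratio_H \<nu> ((\<lambda>t. t + x) ` {-L<..<L}) < e) at_infinity"
    using e by (intro order_tendstoD) auto
  then obtain X where X: "\<And>x. X \<le> norm x \<Longrightarrow> ennreal c * ratio_H \<nu> ((\<lambda>t. t + x) ` {-L<..<L}) < e"
    unfolding eventually_at_infinity by blast
  \<comment> \<open>The minimum of the defining function of \<open>halfplane_end\<close> on the rectangle
    \<open>|Re \<alpha>| \<le> X\<close>, \<open>l0 \<le> 2 * m * Im \<alpha> \<le> L\<close> is at least \<open>\<eta>\<close>.\<close>
  define \<eta> where "\<eta> = (l0 / (2 * m)) / (X\<^sup>2 + (L / (2 * m) + 1)\<^sup>2)"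
  have dpos: "0 < X\<^sup>2 + (L / (2 * m) + 1)\<^sup>2"
    using L m by (intro add_nonneg_pos zero_less_power) (auto simp: add_pos_pos)
  have "0 < \<eta>" unfolding \<eta>_def using l0(1) m dpos by (intro divide_pos_pos) auto
  moreover have "ratio_H \<nu> {Re \<alpha> - m * Im \<alpha><..<Re \<alpha> + m * Im \<alpha>} < e"
    if \<alpha>: "0 < Im \<alpha>" "Im \<alpha> / (norm (\<alpha> + \<i>))\<^sup>2 < \<eta>" for \<alpha>
  proof -
    define I where "I = {Re \<alpha> - m * Im \<alpha><..<Re \<alpha> + m * Im \<alpha>}"
    define l where "l = 2 * m * Im \<alpha>"
    have mp: "0 < m * Im \<alpha>" using m \<alpha>(1) by simp
    have I: "I \<in> real_intervals" "measure lborel I = l"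
      unfolding I_def l_def using mp by (auto intro: real_intervals_Ioo)
    have le: "ratio_H \<nu> I \<le> sup_ratio_H \<nu> l"
      unfolding sup_ratio_H_def using I by (intro SUP_upper) auto
    have l: "0 < l" using mp by (simp add: l_def)
    consider "l < l0" | "L \<le> l" | "l0 \<le> l" "l < L" by linarith
    then have "ratio_H \<nu> I < e"
    proof cases
      case 1 then show ?thesis using l0(2)[OF l] le by (meson le_less_trans)
    next
      case 2 then show ?thesis using L0[of l] L(2) le by (meson le_less_trans order_trans)
    next
      case 3
      have y: "l0 / (2 * m) \<le> Im \<alpha>" "Im \<alpha> \<le> L / (2 * m)"
        using 3 m by (auto simp: l_def field_simps)
      have "X < \<bar>Re \<alpha>\<bar>"
      proof (rule ccontr)
        assume "\<not> X < \<bar>Re \<alpha>\<bar>"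
        then have "(Re \<alpha>)\<^sup>2 \<le> X\<^sup>2" by (metis abs_ge_zero not_less power2_abs power_mono)
        moreover have "(Im \<alpha> + 1)\<^sup>2 \<le> (L / (2 * m) + 1)\<^sup>2"
          using y \<alpha>(1) by (intro power_mono) auto
        ultimately have "(norm (\<alpha> + \<i>))\<^sup>2 \<le> X\<^sup>2 + (L / (2 * m) + 1)\<^sup>2"
          unfolding norm_add_ii_power2 by (rule add_mono)
        moreover have "0 < (norm (\<alpha> + \<i>))\<^sup>2"
          unfolding norm_add_ii_power2 using \<alpha>(1) by (intro add_nonneg_pos) auto
        ultimately have "\<eta> \<le> Im \<alpha> / (norm (\<alpha> + \<i>))\<^sup>2"
          unfolding \<eta>_def using y(1) \<alpha>(1) by (intro frac_le) auto
        then show False using \<alpha>(2) by simp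
      qed
      then have X': "ennreal c * ratio_H \<nu> ((\<lambda>t. t + Re \<alpha>) ` {-L<..<L}) < e"
        by (intro X) simp
      define I' where "I' = {Re \<alpha> - L<..<Re \<alpha> + L}"
      have im: "(\<lambda>t. t + Re \<alpha>) ` {-L<..<L} = I'"
        unfolding I'_def by (auto simp: image_iff intro!: bexI[of _ "_ - Re \<alpha>"])
      have mI': "measure lborel I' = c * l0" using L c by (simp add: I'_def)
      have "2 * (m * Im \<alpha>) < L" using 3 by (simp add: l_def mult.assoc)
      then have "I \<subseteq> I'" unfolding I_def I'_def using mp by auto
      then have "box_H I \<subseteq> box_H I'"
        unfolding box_H_def I(2) mI' c(2) using 3 L by auto
      then have "emeasure \<nu> (box_H I) \<le> emeasure \<nu> (box_H I')"
        unfolding I'_def by (intro emeasure_mono box_H_in_sets[OF sets])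
      have "ratio_H \<nu> I = ennreal (l0 / l) * (emeasure \<nu> (box_H I) / ennreal l0)"
        unfolding ratio_H_def I(2) using ennreal_divide_rescale[of "l0 / l" l "emeasure \<nu> (box_H I)"] l l0(1) by simp
      also have "\<dots> \<le> 1 * (emeasure \<nu> (box_H I') / ennreal l0)"
        using 3 l \<open>emeasure \<nu> (box_H I) \<le> emeasure \<nu> (box_H I')\<close>
        by (intro mult_mono divide_right_mono_ennreal) (auto simp: ennreal_le_1)
      also have "\<dots> = ennreal c * ratio_H \<nu> I'"
        unfolding ratio_H_def mI' using ennreal_divide_rescale[OF c(1) l0(1)] by simp
      also have "\<dots> < e" using X' unfolding im .
      finally show ?thesis .
    qed
    then show ?thesis unfolding I_def .
  qed
  ultimately show "eventually (\<lambda>\<alpha>. ratio_H \<nu> {Re \<alpha> - m * Im \<alpha><..<Re \<alpha> + m * Im \<alpha>} < e) halfplane_end"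
    unfolding eventually_halfplane_end by blast
qed simp

text \<open>
  The \<open>k\<close>-th dyadic interval is a fixed multiple of \<open>Im \<alpha>\<close> long, so each
  term of the series vanishes at the boundary.
\<close>
lemma halfplane_poisson_tendsto_0:
  assumes \<nu>: "\<nu> \<in> CM_s_H"
  shows "(halfplane_poisson \<nu> \<longlongrightarrow> 0) halfplane_end"
proof -
  have fin: "(SUP I\<in>real_intervals. ratio_H \<nu> I) < \<infinity>"
    and sets: "sets \<nu> = sets (restrict_space borel upper_half_plane)"
    using \<nu> by (auto simp: CM_s_H_def CM_H_def positive_measure_on_def)
  define \<rho> where "\<rho> \<alpha> k = ratio_H \<nu> {Re \<alpha> - 2 ^ Suc k * Im \<alpha><..<Re \<alpha> + 2 ^ Suc k * Im \<alpha>}"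
    for \<alpha> and k :: nat
  have "((\<lambda>\<alpha>. \<Sum>k. ennreal ((1/2)^k) * \<rho> \<alpha> k) \<longlongrightarrow> 0) halfplane_end"
  proof (rule tendsto_geometric_suminf_ennreal[OF fin])
    show "eventually (\<lambda>\<alpha>. \<forall>k. \<rho> \<alpha> k \<le> (SUP I\<in>real_intervals. ratio_H \<nu> I)) halfplane_end"
      using eventually_halfplane_end_pos
    proof eventually_elim
      case (elim \<alpha>)
      then show ?case unfolding \<rho>_def by (intro allI SUP_upper real_intervals_Ioo) auto
    qed
    show "((\<lambda>\<alpha>. \<rho> \<alpha> k) \<longlongrightarrow> 0) halfplane_end" for k
      unfolding \<rho>_def by (rule ratio_H_tendsto_0_halfplane_end[OF \<nu>]) simp
  qed
  then have "((\<lambda>\<alpha>. 4 * (\<Sum>k. ennreal ((1/2)^k) * \<rho> \<alpha> k)) \<longlongrightarrow> 4 * 0) halfplane_end"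
    by (intro tendsto_mult_ennreal tendsto_const) auto
  then have up: "((\<lambda>\<alpha>. 4 * (\<Sum>k. ennreal ((1/2)^k) * \<rho> \<alpha> k)) \<longlongrightarrow> 0) halfplane_end"
    by simp
  have "eventually (\<lambda>\<alpha>. halfplane_poisson \<nu> \<alpha> \<le> 4 * (\<Sum>k. ennreal ((1/2)^k) * \<rho> \<alpha> k)) halfplane_end"
    using eventually_halfplane_end_pos by eventually_elim (use halfplane_poisson_le_dyadic[OF sets] in \<open>simp add: \<rho>_def\<close>)
  then show ?thesis
    by (intro tendsto_sandwich[OF _ _ tendsto_const up]) auto
qed

section \<open>The Cayley transform\<close>

definition cayley :: "complex \<Rightarrow> complex" where
  "cayley z = (z - \<i>) / (z + \<i>)"

definition cayley_inv :: "complex \<Rightarrow> complex" where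
  "cayley_inv w = \<i> * (1 + w) / (1 - w)"

lemma halfplane_add_ii_nonzero: "0 < Im z \<Longrightarrow> z + \<i> \<noteq> 0"
  by (auto simp: complex_eq_iff)

lemma one_minus_norm_cayley:
  assumes "0 < Im \<alpha>"
  shows "1 - (norm (cayley \<alpha>))\<^sup>2 = 4 * (Im \<alpha> / (norm (\<alpha> + \<i>))\<^sup>2)"
proof -
  have "(norm (\<alpha> + \<i>))\<^sup>2 - (norm (\<alpha> - \<i>))\<^sup>2 = 4 * Im \<alpha>"
    unfolding cmod_power2 by (simp add: power2_eq_square algebra_simps)
  moreover have "0 < (norm (\<alpha> + \<i>))\<^sup>2" using halfplane_add_ii_nonzero[OF assms] by simp
  ultimately show ?thesis
    by (simp add: cayley_def norm_divide power_divide field_simps)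
qed

lemma cayley_in_unit_disk: "0 < Im \<alpha> \<Longrightarrow> cayley \<alpha> \<in> unit_disk"
proof -
  assume \<alpha>: "0 < Im \<alpha>"
  have "0 < Im \<alpha> / (norm (\<alpha> + \<i>))\<^sup>2"
    using \<alpha> halfplane_add_ii_nonzero[OF \<alpha>] by simp
  then have "(norm (cayley \<alpha>))\<^sup>2 < 1"
    using one_minus_norm_cayley[OF \<alpha>] by linarith
  then show ?thesis by (simp add: unit_disk_def abs_square_less_1)
qed

lemma cayley_inv_in_halfplane:
  assumes "w \<in> unit_disk"
  shows "0 < Im (cayley_inv w)"
proof -
  have w: "norm w < 1" using assms by (simp add: unit_disk_def)
  then have ne: "w \<noteq> 1" by auto
  have "Im (cayley_inv w) = (1 - (norm w)\<^sup>2) / (norm (1 - w))\<^sup>2"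
    unfolding cayley_inv_def cmod_power2 Im_divide
    by (simp add: power2_eq_square algebra_simps)
  moreover have "(norm w)\<^sup>2 < 1" using w by (simp add: abs_square_less_1)
  ultimately show ?thesis using ne by simp
qed

lemma cayley_cayley_inv:
  assumes "w \<in> unit_disk"
  shows "cayley (cayley_inv w) = w"
proof -
  have "w \<noteq> 1" using assms by (auto simp: unit_disk_def)
  then have ne: "1 - w \<noteq> 0" by simp
  have "cayley_inv w - \<i> = 2 * \<i> * w / (1 - w)" "cayley_inv w + \<i> = 2 * \<i> / (1 - w)"
    unfolding cayley_inv_def using ne by (simp_all add: field_simps)
  then show ?thesis using ne by (simp add: cayley_def)
qed

lemma cayley_inv_cayley:
  assumes "0 < Im z"
  shows "cayley_inv (cayley z) = z"
proof -
  have ne: "z + \<i> \<noteq> 0" by (rule halfplane_add_ii_nonzero[OF assms])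
  have "1 + cayley z = 2 * z / (z + \<i>)" "1 - cayley z = 2 * \<i> / (z + \<i>)"
    unfolding cayley_def using ne by (simp_all add: field_simps)
  then show ?thesis using ne by (simp add: cayley_inv_def)
qed

lemma norm_deriv_cayley:
  assumes "0 < Im z"
  shows "inverse (norm (deriv cayley z)) = (norm (z + \<i>))\<^sup>2 / 2"
proof -
  have ne: "z + \<i> \<noteq> 0" by (rule halfplane_add_ii_nonzero[OF assms])
  have "(cayley has_field_derivative (2 * \<i> / (z + \<i>)\<^sup>2)) (at z)"
    unfolding cayley_def [abs_def] using ne
    by (auto intro!: derivative_eq_intros simp: power2_eq_square)
  then have "deriv cayley z = 2 * \<i> / (z + \<i>)\<^sup>2" by (rule DERIV_imp_deriv)
  then show ?thesis by (simp add: norm_divide norm_mult norm_power)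
qed

text \<open>
  Writing the pull-back as a push-forward under the inverse map makes the change of variables for
  integrals available.
\<close>
lemma pullback_cayley_eq_distr:
  assumes \<mu>: "sets \<mu> = sets (restrict_space borel unit_disk)"
  shows "cayley_inv \<in> measurable \<mu> (restrict_space borel upper_half_plane)"
    and "pullback_measure upper_half_plane cayley \<mu> = distr \<mu> (restrict_space borel upper_half_plane) cayley_inv"
proof -
  have sp: "space \<mu> = unit_disk"
    using sets_eq_imp_space_eq[OF \<mu>] by (simp add: space_restrict_space)
  have "continuous_on unit_disk cayley_inv"
    unfolding cayley_inv_def by (intro continuous_intros) (auto simp: unit_disk_def)
  then have "cayley_inv \<in> borel_measurable (restrict_space borel unit_disk)"
    by (rule borel_measurable_continuous_on_restrict)
  then have "cayley_inv \<in> borel_measurable \<mu>"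
    using measurable_cong_sets[OF \<mu> refl] by blast
  then show meas: "cayley_inv \<in> measurable \<mu> (restrict_space borel upper_half_plane)"
    by (rule measurable_restrict_space2[rotated])
      (auto simp: sp upper_half_plane_def intro: cayley_inv_in_halfplane)
  have img: "cayley ` E = cayley_inv -` E \<inter> space \<mu>" if "E \<subseteq> upper_half_plane" for E
  proof (intro equalityI subsetI)
    fix w assume "w \<in> cayley ` E"
    then show "w \<in> cayley_inv -` E \<inter> space \<mu>"
      using that by (auto simp: sp upper_half_plane_def cayley_inv_cayley cayley_in_unit_disk subset_iff)
  next
    fix w assume "w \<in> cayley_inv -` E \<inter> space \<mu>"
    then show "w \<in> cayley ` E"
      by (metis IntD1 IntD2 cayley_cayley_inv image_eqI sp vimageE)
  qed
  have sub: "E \<subseteq> upper_half_plane" if "E \<in> sets (restrict_space borel upper_half_plane)" for E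
    using sets.sets_into_space[OF that] by (simp add: space_restrict_space)
  show "pullback_measure upper_half_plane cayley \<mu> = distr \<mu> (restrict_space borel upper_half_plane) cayley_inv"
  proof (rule measure_eqI)
    show "sets (pullback_measure upper_half_plane cayley \<mu>) =
        sets (distr \<mu> (restrict_space borel upper_half_plane) cayley_inv)"
      by (simp add: sets_pullback_measure)
    fix E assume "E \<in> sets (pullback_measure upper_half_plane cayley \<mu>)"
    then have E: "E \<in> sets (restrict_space borel upper_half_plane)"
      by (simp add: sets_pullback_measure)
    have "emeasure (pullback_measure upper_half_plane cayley \<mu>) E = emeasure \<mu> (cayley ` E)"
    proof (rule emeasure_pullback_measure[OF _ _ E])
      show "inj_on cayley upper_half_plane"
        by (rule inj_on_inverseI[of _ cayley_inv]) (simp add: upper_half_plane_def cayley_inv_cayley)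
      show "cayley ` F \<in> sets \<mu>" if "F \<in> sets (restrict_space borel upper_half_plane)" for F
        unfolding img[OF sub[OF that]] by (rule measurable_sets[OF meas that])
    qed
    then show "emeasure (pullback_measure upper_half_plane cayley \<mu>) E =
        emeasure (distr \<mu> (restrict_space borel upper_half_plane) cayley_inv) E"
      by (simp add: emeasure_distr[OF meas E] img[OF sub[OF E]])
  qed
qed

lemma sets_associated_measure:
  "sets (associated_measure S g \<mu>) = sets (restrict_space borel S)"
  by (simp add: associated_measure_def sets_pullback_measure)

lemma nn_integral_associated_measure:
  assumes \<mu>: "sets \<mu> = sets (restrict_space borel unit_disk)"
    and f: "f \<in> borel_measurable borel"
  shows "(\<integral>\<^sup>+z. f z \<partial>associated_measure upper_half_plane cayley \<mu>) =
    (\<integral>\<^sup>+w. ennreal ((norm (cayley_inv w + \<i>))\<^sup>2 / 2) * f (cayley_inv w) \<partial>\<mu>)"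
proof -
  let ?H = "restrict_space borel upper_half_plane"
  let ?P = "pullback_measure upper_half_plane cayley \<mu>"
  note P = pullback_cayley_eq_distr[OF \<mu>]
  have spP: "space ?P = upper_half_plane"
    unfolding P(2) by (simp add: space_restrict_space)
  have k: "(\<lambda>z. ennreal ((norm (z + \<i>))\<^sup>2 / 2)) \<in> borel_measurable ?P"
    by (rule borel_measurable_restrict_sets[OF sets_pullback_measure]) simp
  have fP: "f \<in> borel_measurable ?P"
    by (rule borel_measurable_restrict_sets[OF sets_pullback_measure f])
  have eq: "ennreal (inverse (norm (deriv cayley z))) = ennreal ((norm (z + \<i>))\<^sup>2 / 2)" if "z \<in> space ?P" for z
  proof -
    have "0 < Im z" using that unfolding spP by (simp add: upper_half_plane_def)
    then show ?thesis by (simp only: norm_deriv_cayley)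
  qed
  have d: "(\<lambda>z. ennreal (inverse (norm (deriv cayley z)))) \<in> borel_measurable ?P"
    by (subst measurable_cong[OF eq]) (assumption, rule k)
  have "(\<integral>\<^sup>+z. f z \<partial>associated_measure upper_half_plane cayley \<mu>) =
      (\<integral>\<^sup>+z. ennreal (inverse (norm (deriv cayley z))) * f z \<partial>?P)"
    unfolding associated_measure_def by (rule nn_integral_density[OF d fP])
  also have "\<dots> = (\<integral>\<^sup>+z. ennreal ((norm (z + \<i>))\<^sup>2 / 2) * f z \<partial>?P)"
    by (rule nn_integral_cong) (simp only: eq)
  also have "\<dots> = (\<integral>\<^sup>+w. ennreal ((norm (cayley_inv w + \<i>))\<^sup>2 / 2) * f (cayley_inv w) \<partial>\<mu>)"
    unfolding P(2) by (rule nn_integral_distr[OF P(1)])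
      (use k fP P(2) measurable_distr_eq1 in \<open>auto intro: measurable_restrict_space1 f\<close>)
  finally show ?thesis .
qed

text \<open>
  The conformal covariance behind the theorem.  The factor \<open>|z + i|^2 / 2\<close> is
  \<open>1 / |\<gamma>'(z)|\<close>; the factor \<open>|\<alpha> + i|^2\<close> cancels between
  \<open>1 - |\<gamma> \<alpha>|^2\<close> and
  \<open>1 - cnj (\<gamma> \<alpha>) * \<gamma> z = 2 * i * (cnj \<alpha> - z) / ((cnj \<alpha> - i) * (z + i))\<close>.
\<close>
lemma poisson_kernel_cayley:
  assumes z: "0 < Im z" and \<alpha>: "0 < Im \<alpha>"
  shows "2 * ((norm (z + \<i>))\<^sup>2 / 2 * (Im \<alpha> / (norm (z - cnj \<alpha>))\<^sup>2)) =
    (1 - (norm (cayley \<alpha>))\<^sup>2) / (norm (1 - cnj (cayley \<alpha>) * cayley z))\<^sup>2"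
proof -
  have ne: "z + \<i> \<noteq> 0" "\<alpha> + \<i> \<noteq> 0" using z \<alpha> halfplane_add_ii_nonzero by auto
  have ne2: "cnj \<alpha> - \<i> \<noteq> 0" "norm (cnj \<alpha> - \<i>) = norm (\<alpha> + \<i>)"
  proof -
    have "cnj \<alpha> - \<i> = cnj (\<alpha> + \<i>)" by simp
    then show "norm (cnj \<alpha> - \<i>) = norm (\<alpha> + \<i>)" by (simp only: complex_mod_cnj)
    then show "cnj \<alpha> - \<i> \<noteq> 0" using ne(2) by auto
  qed
  have ne3: "z - cnj \<alpha> \<noteq> 0" using z \<alpha> by (auto simp: complex_eq_iff)
  have cnj_cayley: "cnj (cayley \<alpha>) = (cnj \<alpha> + \<i>) / (cnj \<alpha> - \<i>)"
    by (simp add: cayley_def)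
  have "1 - cnj (cayley \<alpha>) * cayley z =
      ((cnj \<alpha> - \<i>) * (z + \<i>) - (cnj \<alpha> + \<i>) * (z - \<i>)) / ((cnj \<alpha> - \<i>) * (z + \<i>))"
  proof -
    have frac: "1 - A / B * (C / D) = (B * D - A * C) / (B * D)" if "B \<noteq> 0" "D \<noteq> 0" for A B C D :: complex
      using that by (simp add: field_simps)
    show ?thesis by (simp only: cnj_cayley cayley_def[of z] frac[OF ne2(1) ne(1)])
  qed
  also have "(cnj \<alpha> - \<i>) * (z + \<i>) - (cnj \<alpha> + \<i>) * (z - \<i>) = 2 * \<i> * (cnj \<alpha> - z)"
    by (simp add: algebra_simps)
  finally have "1 - cnj (cayley \<alpha>) * cayley z = 2 * \<i> * (cnj \<alpha> - z) / ((cnj \<alpha> - \<i>) * (z + \<i>))" .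
  then have "norm (1 - cnj (cayley \<alpha>) * cayley z) = 2 * norm (z - cnj \<alpha>) / (norm (\<alpha> + \<i>) * norm (z + \<i>))"
    using ne2(2) by (simp add: norm_divide norm_mult norm_minus_commute)
  then show ?thesis
    unfolding one_minus_norm_cayley[OF \<alpha>] using ne ne3
    by (simp add: power_divide power_mult_distrib)
qed

lemma disk_poisson_cayley:
  assumes \<mu>: "sets \<mu> = sets (restrict_space borel unit_disk)" and \<alpha>: "0 < Im \<alpha>"
  shows "disk_poisson \<mu> (cayley \<alpha>) =
    2 * halfplane_poisson (associated_measure upper_half_plane cayley \<mu>) \<alpha>"
proof -
  have sp: "space \<mu> = unit_disk"
    using sets_eq_imp_space_eq[OF \<mu>] by (simp add: space_restrict_space)
  have meas: "(\<lambda>w. ennreal ((norm (cayley_inv w + \<i>))\<^sup>2 / 2) * ennreal (Im \<alpha> / (norm (cayley_inv w - cnj \<alpha>))\<^sup>2)) \<in> borel_measurable \<mu>"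
    by (rule measurable_compose[OF pullback_cayley_eq_distr(1)[OF \<mu>],
          where g = "\<lambda>z. ennreal ((norm (z + \<i>))\<^sup>2 / 2) * ennreal (Im \<alpha> / (norm (z - cnj \<alpha>))\<^sup>2)"])
      (rule measurable_restrict_space1, measurable)
  have "2 * halfplane_poisson (associated_measure upper_half_plane cayley \<mu>) \<alpha> =
      2 * (\<integral>\<^sup>+w. ennreal ((norm (cayley_inv w + \<i>))\<^sup>2 / 2) * ennreal (Im \<alpha> / (norm (cayley_inv w - cnj \<alpha>))\<^sup>2) \<partial>\<mu>)"
    unfolding halfplane_poisson_def by (subst nn_integral_associated_measure[OF \<mu>]) simp_all
  also have "\<dots> = (\<integral>\<^sup>+w. 2 * (ennreal ((norm (cayley_inv w + \<i>))\<^sup>2 / 2) * ennreal (Im \<alpha> / (norm (cayley_inv w - cnj \<alpha>))\<^sup>2)) \<partial>\<mu>)"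
    by (rule nn_integral_cmult[symmetric]) (rule meas)
  also have "\<dots> = disk_poisson \<mu> (cayley \<alpha>)"
    unfolding disk_poisson_def
  proof (rule nn_integral_cong)
    fix w assume "w \<in> space \<mu>"
    then have w: "w \<in> unit_disk" by (simp add: sp)
    have "2 * (ennreal ((norm (cayley_inv w + \<i>))\<^sup>2 / 2) * ennreal (Im \<alpha> / (norm (cayley_inv w - cnj \<alpha>))\<^sup>2)) =
        ennreal (2 * ((norm (cayley_inv w + \<i>))\<^sup>2 / 2 * (Im \<alpha> / (norm (cayley_inv w - cnj \<alpha>))\<^sup>2)))"
      using \<alpha> by (subst ennreal_mult, simp, simp, subst ennreal_mult) simp_all
    also have "\<dots> = ennreal ((1 - (norm (cayley \<alpha>))\<^sup>2) / (norm (1 - cnj (cayley \<alpha>) * w))\<^sup>2)"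
      unfolding poisson_kernel_cayley[OF cayley_inv_in_halfplane[OF w] \<alpha>] cayley_cayley_inv[OF w] ..
    finally show "2 * (ennreal ((norm (cayley_inv w + \<i>))\<^sup>2 / 2) * ennreal (Im \<alpha> / (norm (cayley_inv w - cnj \<alpha>))\<^sup>2)) =
        ennreal ((1 - (norm (cayley \<alpha>))\<^sup>2) / (norm (1 - cnj (cayley \<alpha>) * w))\<^sup>2)" .
  qed
  finally show ?thesis ..
qed

lemma filterlim_cayley: "filterlim cayley disk_end halfplane_end"
proof -
  have "filterlim (\<lambda>\<alpha>. Im \<alpha> / (norm (\<alpha> + \<i>))\<^sup>2) (at_right 0) halfplane_end"
    unfolding halfplane_end_def by (rule filterlim_filtercomap)
  then have "filterlim (\<lambda>\<alpha>. 4 * (Im \<alpha> / (norm (\<alpha> + \<i>))\<^sup>2)) (at_right 0) halfplane_end"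
    by (rule filterlim_compose[OF filterlim_mult_at_right_0, rotated]) simp
  moreover have "eventually (\<lambda>\<alpha>. 4 * (Im \<alpha> / (norm (\<alpha> + \<i>))\<^sup>2) = 1 - (norm (cayley \<alpha>))\<^sup>2) halfplane_end"
    using eventually_halfplane_end_pos by eventually_elim (rule one_minus_norm_cayley[symmetric])
  ultimately have "filterlim (\<lambda>\<alpha>. 1 - (norm (cayley \<alpha>))\<^sup>2) (at_right 0) halfplane_end"
    by (rule filterlim_mono_eventually[OF _ order_refl order_refl])
  then show ?thesis
    by (simp only: disk_end_def filterlim_filtercomap_iff o_def)
qed

lemma filterlim_cayley_inv: "filterlim cayley_inv halfplane_end disk_end"
proof -
  have "filterlim (\<lambda>a. 1 - (norm a)\<^sup>2) (at_right 0) disk_end"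
    unfolding disk_end_def by (rule filterlim_filtercomap)
  then have "filterlim (\<lambda>a. 1/4 * (1 - (norm a)\<^sup>2)) (at_right 0) disk_end"
    by (rule filterlim_compose[OF filterlim_mult_at_right_0, rotated]) simp
  moreover have "eventually (\<lambda>a. 1/4 * (1 - (norm a)\<^sup>2) = Im (cayley_inv a) / (norm (cayley_inv a + \<i>))\<^sup>2) disk_end"
    using eventually_disk_end_unit_disk
  proof eventually_elim
    case (elim a)
    then show ?case
      using one_minus_norm_cayley[OF cayley_inv_in_halfplane[OF elim]] cayley_cayley_inv[OF elim] by simp
  qed
  ultimately have "filterlim (\<lambda>a. Im (cayley_inv a) / (norm (cayley_inv a + \<i>))\<^sup>2) (at_right 0) disk_end"
    by (rule filterlim_mono_eventually[OF _ order_refl order_refl])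
  then show ?thesis
    by (simp only: halfplane_end_def filterlim_filtercomap_iff o_def)
qed

section \<open>Equivalence of the vanishing conditions\<close>

theorem theorem3p7:
  fixes lam nu :: "complex measure" and \<gamma> :: "complex \<Rightarrow> complex"
  assumes "lam \<in> CM_D"
    and "\<gamma> = (\<lambda>z. (z - \<i>) / (z + \<i>))"
    and "nu = associated_measure upper_half_plane \<gamma> lam"
  shows "lam \<in> CM_0_D \<longleftrightarrow> nu \<in> CM_s_H"
proof -
  have \<gamma>: "\<gamma> = cayley" unfolding assms(2) cayley_def[abs_def] ..
  note nu = assms(3)[unfolded \<gamma>]
  have lam: "positive_measure_on unit_disk lam" using assms(1) by (simp add: CM_D_def)
  note sets_lam = positive_measure_onD(1)[OF lam]
  have sets_nu: "sets nu = sets (restrict_space borel upper_half_plane)"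
    unfolding nu by (rule sets_associated_measure)
  have key: "disk_poisson lam (cayley \<alpha>) = 2 * halfplane_poisson nu \<alpha>" if "0 < Im \<alpha>" for \<alpha>
    unfolding nu by (rule disk_poisson_cayley[OF sets_lam that])
  have le: "halfplane_poisson nu \<alpha> \<le> disk_poisson lam (cayley \<alpha>)" if "0 < Im \<alpha>" for \<alpha>
    unfolding key[OF that] using mult_right_mono[of 1 2 "halfplane_poisson nu \<alpha>"] by simp
  show ?thesis
  proof
    assume van: "lam \<in> CM_0_D"
    obtain C where C: "C < \<infinity>" "\<And>a. a \<in> unit_disk \<Longrightarrow> disk_poisson lam a \<le> C"
      using disk_poisson_bounded[OF assms(1)] by blast
    show "nu \<in> CM_s_H"
    proof (rule CM_s_H_if_halfplane_poisson[OF sets_nu C(1)])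
      show "halfplane_poisson nu \<alpha> \<le> C" if "\<alpha> \<in> upper_half_plane" for \<alpha>
        using that le[of \<alpha>] C(2)[OF cayley_in_unit_disk[of \<alpha>]] by (auto simp: upper_half_plane_def)
      have up: "((\<lambda>\<alpha>. disk_poisson lam (cayley \<alpha>)) \<longlongrightarrow> 0) halfplane_end"
        by (rule filterlim_compose[OF disk_poisson_tendsto_0[OF van] filterlim_cayley])
      have "eventually (\<lambda>\<alpha>. halfplane_poisson nu \<alpha> \<le> disk_poisson lam (cayley \<alpha>)) halfplane_end"
        using eventually_halfplane_end_pos by eventually_elim (rule le)
      then show "(halfplane_poisson nu \<longlongrightarrow> 0) halfplane_end"
        by (intro tendsto_sandwich[OF _ _ tendsto_const up]) auto
    qed
  next
    assume van: "nu \<in> CM_s_H"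
    have "((\<lambda>a. halfplane_poisson nu (cayley_inv a)) \<longlongrightarrow> 0) disk_end"
      by (rule filterlim_compose[OF halfplane_poisson_tendsto_0[OF van] filterlim_cayley_inv])
    then have "((\<lambda>a. 2 * halfplane_poisson nu (cayley_inv a)) \<longlongrightarrow> 2 * 0) disk_end"
      by (intro tendsto_mult_ennreal tendsto_const) auto
    moreover have "eventually (\<lambda>a. 2 * halfplane_poisson nu (cayley_inv a) = disk_poisson lam a) disk_end"
      using eventually_disk_end_unit_disk
    proof eventually_elim
      case (elim a)
      then show ?case using key[OF cayley_inv_in_halfplane[OF elim]] by (simp add: cayley_cayley_inv)
    qed
    ultimately have "(disk_poisson lam \<longlongrightarrow> 0) disk_end"
      using tendsto_cong by force
    then show "lam \<in> CM_0_D"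
      using assms(1) sup_ratio_D_tendsto_0[OF lam] by (simp add: CM_0_D_def)
  qed
qed

end
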